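(* Let $m\neq 0$ be an integer. The discrete sequence $$0\longrightarrow Z_h^{m,0}\xrightarrow{\ \mathrm{grad}^m\ }Z_h^{m,1}\xrightarrow{\ \mathrm{curl}^m\ }Z_h^{m,2}\xrightarrow{\ \mathrm{div}^m\ }Z_h^{m,3}\longrightarrow 0$$ is exact, i.e. each operator maps each space into the next one, $\mathrm{grad}^m$ is injective on $Z_h^{m,0}$, $\mathrm{grad}^m(Z_h^{m,0})=\ker(\mathrm{curl}^m|_{Z_h^{m,1}})$, $\mathrm{curl}^m(Z_h^{m,1})=\ker(\mathrm{div}^m|_{Z_h^{m,2}})$, and $\mathrm{div}^m(Z_h^{m,2})=Z_h^{m,3}$.
   Context: Domain. $S\subset\mathbb{R}^+\times\mathbb{R}$ is a bounded Lipschitz domain with coordinates $(\rho,z)$, $\rho>0$, which is the image of the unit square under a diffeomorphism $\mathbf F$; $\partial S\cap\{\rho=0\}$ is either empty or equal to $\mathbf F(\{0\}\times[0,1])$. $m\ne 0$ is an integer. Vector fields are written $\mathbf u=(u_\rho,u_z,u_\theta)$, functions on $S$ with values in $\mathbb{R}^3$, and $\mathbf u_{\rho z}=(u_\rho,u_z)$. Operators (in the weak sense on $S$): $\mathrm{grad}^m u=(\partial_\rho u,\ \partial_z u,\ -\tfrac m\rho u)$; $\mathrm{curl}^m\mathbf u=\big(-\tfrac m\rho u_z-\partial_z u_\theta,\ \tfrac1\rho(\partial_\rho(\rho u_\theta)+m u_\rho),\ \partial_z u_\rho-\partial_\rho u_z\big)$; $\mathrm{div}^m\mathbf u=\tfrac1\rho\partial_\rho(\rho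 u_\rho)-\tfrac m\rho u_\theta+\partial_z u_z$. Two-dimensional Cartesian spaces (unweighted Lebesgue measure $d\rho\,dz$): $X^0=H^1(S)$; $X^1=\{\mathbf u\in L^2(S;\mathbb{R}^2):\mathrm{curl}\,\mathbf u\in L^2(S)\}$ with scalar curl $\mathrm{curl}\,(u_\rho,u_z)=\partial_\rho u_z-\partial_z u_\rho$; $X^{1*}=\{\mathbf u\in L^2(S;\mathbb{R}^2):\mathrm{div}\,\mathbf u\in L^2(S)\}$ with $\mathrm{div}(u_\rho,u_z)=\partial_\rho u_\rho+\partial_z u_z$; $X^2=L^2(S)$. Also $\mathrm{grad}\,u=(\partial_\rho u,\partial_z u)$, $\mathrm{rot}\,u=(\partial_z u,-\partial_\rho u)=P\,\mathrm{grad}\,u$, where $P=\begin{pmatrix}0&1\\-1&0\end{pmatrix}$. Discrete Cartesian spaces (standing assumptions): $X_h^0\subset X^0$, $X_h^1\subset X^1$, $X_h^{1*}\subset X^{1*}$, $X_h^2\subset X^2$ are finite-dimensional subspaces with $\mathrm{grad}\,X_h^0\subset X_h^1$, $\mathrm{curl}\,X_h^1\subset X_h^2$, $\mathrm{rot}\,X_h^0\subset X_h^{1*}$, $\mathrm{div}\,X_h^{1*}\subset X_h^2$, and $X_h^{1*}=P X_h^1$. They come with $L^2$-stable projectors $\Pi^k:X^k\to X_h^k$, $k=0,1,1*,2$, commuting with these operators: $\mathrm{grad}\,\Pi^0=\Pi^1\mathrm{grad}$, $\mathrm{curl}\,\Pi^1=\Pi^2\mathrm{curl}$, $\mathrm{rot}\,\Pi^0=\Pi^{1*}\mathrm{rot}$,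 $\mathrm{div}\,\Pi^{1*}=\Pi^2\mathrm{div}$. Maps linking cylindrical and Cartesian functions: $\eta_{m,0}(u)=\tfrac m\rho u$; $\eta_{m,1}(\mathbf u)=\big(\tfrac1\rho(m u_\rho+u_\theta),\ \tfrac m\rho u_z,\ u_\theta\big)$; $\eta_{m,2}(\mathbf u)=\big(u_\rho,\ u_z,\ \tfrac1\rho(m u_\theta-u_\rho)\big)$; $\eta_{m,3}(u)=u$. Their (pointwise) inverses are $\eta_{m,0}^{-1}(\tilde u)=\tfrac\rho m\tilde u$; $\eta_{m,1}^{-1}(\tilde{\mathbf u})=\big(\tfrac1m(\rho\tilde u_\rho-\tilde u_\theta),\tfrac\rho m\tilde u_z,\tilde u_\theta\big)$; $\eta_{m,2}^{-1}(\tilde{\mathbf u})=\big(\tilde u_\rho,\tilde u_z,\tfrac1m(\rho\tilde u_\theta+\tilde u_\rho)\big)$; $\eta_{m,3}^{-1}(\tilde u)=\tilde u$. Discrete cylindrical spaces: $Z_h^{m,0}=\eta_{m,0}^{-1}(X_h^0)$, $Z_h^{m,1}=\eta_{m,1}^{-1}(X_h^1\times X_h^0)$, $Z_h^{m,2}=\eta_{m,2}^{-1}(X_h^{1*}\times X_h^2)$, $Z_h^{m,3}=\eta_{m,3}^{-1}(X_h^2)$, where in the products the first factor carries the $(\rho,z)$ components and the second factor the $\theta$ component. *)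

theory Defs
  imports "HOL-Analysis.Analysis"
begin

text \<open>
  Points are pairs \<open>(\<rho>, z)\<close>; a field \<open>(u\<^sub>\<rho>, u\<^sub>z, u\<^sub>\<theta>)\<close> takes values in \<open>real \<times> real \<times> real\<close>,
  in this order. A function on \<open>S\<close> is represented by a total function whose values outside \<open>S\<close>
  are irrelevant. Elements of \<open>L\<^sup>2(S)\<close> are such representatives, and every function space below is
  closed under equality almost everywhere on \<open>S\<close>, so that equality of these sets of
  representatives is equality of the spaces of equivalence classes.
\<close>

type_synonym point = "real \<times> real"
type_synonym scalar_field = "point \<Rightarrow> real"
type_synonym planar_field = "point \<Rightarrow> real \<times> real"
type_synonym cyl_field = "point \<Rightarrow> real \<times> real \<times> real"


section \<open>The domain\<close>

definition lipschitz_domain :: "point set \<Rightarrow> bool" where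
  "lipschitz_domain S \<longleftrightarrow> open S \<and> connected S \<and> S \<noteq> {} \<and>
     (\<forall>p\<in>frontier S. \<exists>r>0. \<exists>(R :: point \<Rightarrow> point) C \<gamma>. orthogonal_transformation R \<and> C-lipschitz_on UNIV \<gamma> \<and>
        S \<inter> ball p r = {p + R (s, t) | s t. t > (\<gamma> s :: real)} \<inter> ball p r)"

text \<open>Derivatives are taken within \<open>A\<close>, so on the closed unit square they are one-sided at the
  boundary.\<close>

definition C1_on :: "point set \<Rightarrow> (point \<Rightarrow> point) \<Rightarrow> bool" where
  "C1_on A f \<longleftrightarrow> (\<exists>f' :: point \<Rightarrow> point \<Rightarrow>\<^sub>L point. continuous_on A f' \<and>
     (\<forall>x\<in>A. (f has_derivative blinfun_apply (f' x)) (at x within A)))"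

definition C1_diffeomorphism_on :: "point set \<Rightarrow> (point \<Rightarrow> point) \<Rightarrow> bool" where
  "C1_diffeomorphism_on A f \<longleftrightarrow>
     (\<exists>g. homeomorphism A (f ` A) f g \<and> C1_on A f \<and> C1_on (f ` A) g)"

definition meridian_domain :: "point set \<Rightarrow> (point \<Rightarrow> point) \<Rightarrow> bool" where
  "meridian_domain S F \<longleftrightarrow>
     bounded S \<and> lipschitz_domain S \<and> (\<forall>x\<in>S. fst x > 0) \<and>
     C1_diffeomorphism_on ({0..1} \<times> {0..1}) F \<and>
     S = F ` ({0<..<1} \<times> {0<..<1}) \<and>
     (frontier S \<inter> {x. fst x = 0} = {} \<or>
      frontier S \<inter> {x. fst x = 0} = F ` ({0} \<times> {0..1}))"


section \<open>Functions modulo null sets\<close>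

definition ae_eq :: "point set \<Rightarrow> (point \<Rightarrow> 'b) \<Rightarrow> (point \<Rightarrow> 'b) \<Rightarrow> bool" where
  "ae_eq S u v \<longleftrightarrow> (AE x in lebesgue_on S. u x = v x)"

definition L2 :: "point set \<Rightarrow> (point \<Rightarrow> 'b::euclidean_space) set" where
  "L2 S = {u. u \<in> borel_measurable (lebesgue_on S) \<and>
              integrable (lebesgue_on S) (\<lambda>x. (norm (u x))\<^sup>2)}"

definition L2_norm :: "point set \<Rightarrow> (point \<Rightarrow> 'b::euclidean_space) \<Rightarrow> real" where
  "L2_norm S u = sqrt (\<integral>x. (norm (u x))\<^sup>2 \<partial>lebesgue_on S)"

definition locally_integrable :: "point set \<Rightarrow> (point \<Rightarrow> 'b::euclidean_space) \<Rightarrow> bool" where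
  "locally_integrable S u \<longleftrightarrow> (\<forall>K. compact K \<and> K \<subseteq> S \<longrightarrow> u absolutely_integrable_on K)"


section \<open>Test functions and distributions\<close>

definition partial_deriv :: "point \<Rightarrow> scalar_field \<Rightarrow> scalar_field" where
  "partial_deriv i f x = frechet_derivative f (at x) i"

primrec Ck :: "nat \<Rightarrow> scalar_field \<Rightarrow> bool" where
  "Ck 0 f \<longleftrightarrow> continuous_on UNIV f"
| "Ck (Suc k) f \<longleftrightarrow> (\<forall>x. f differentiable (at x)) \<and> (\<forall>i\<in>Basis. Ck k (partial_deriv i f))"

definition test_functions :: "point set \<Rightarrow> scalar_field set" where
  "test_functions S = {\<phi>. (\<forall>k. Ck k \<phi>) \<and>
     compact (closure {x. \<phi> x \<noteq> 0}) \<and> closure {x. \<phi> x \<noteq> 0} \<subseteq> S}"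

text \<open>
  A distribution on \<open>S\<close> is given by its values on \<^term>\<open>test_functions S\<close>. The multiplier \<open>a\<close> in
  \<open>mult a T\<close> is always smooth on \<open>S\<close> below (a constant, \<open>\<rho>\<close> or \<open>1/\<rho>\<close>, with \<open>\<rho> > 0\<close> on \<open>S\<close>).
\<close>

type_synonym distribution = "scalar_field \<Rightarrow> real"

definition reg :: "point set \<Rightarrow> scalar_field \<Rightarrow> distribution" where
  "reg S f = (\<lambda>\<phi>. \<integral>x. f x * \<phi> x \<partial>lebesgue_on S)"

definition mult :: "scalar_field \<Rightarrow> distribution \<Rightarrow> distribution" where
  "mult a T = (\<lambda>\<phi>. T (\<lambda>x. a x * \<phi> x))"

definition D\<rho> :: "distribution \<Rightarrow> distribution" where
  "D\<rho> T = (\<lambda>\<phi>. - T (partial_deriv (1, 0) \<phi>))"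

definition Dz :: "distribution \<Rightarrow> distribution" where
  "Dz T = (\<lambda>\<phi>. - T (partial_deriv (0, 1) \<phi>))"

definition represents :: "point set \<Rightarrow> scalar_field \<Rightarrow> distribution \<Rightarrow> bool" where
  "represents S f T \<longleftrightarrow> locally_integrable S f \<and> (\<forall>\<phi>\<in>test_functions S. reg S f \<phi> = T \<phi>)"


section \<open>Weak differential operators\<close>

text \<open>
  Weak operators are relations: \<open>weak_op S u v\<close> says that the operator, applied to \<open>u\<close> in the sense
  of distributions on \<open>S\<close>, is the locally integrable function \<open>v\<close>. Thus \<open>v\<close> is determined up to
  null sets, and need not exist.
\<close>

definition weak_grad :: "point set \<Rightarrow> scalar_field \<Rightarrow> planar_field \<Rightarrow> bool" where
  "weak_grad S u v \<longleftrightarrow> locally_integrable S u \<and>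
     represents S (\<lambda>x. fst (v x)) (D\<rho> (reg S u)) \<and>
     represents S (\<lambda>x. snd (v x)) (Dz (reg S u))"

definition weak_rot :: "point set \<Rightarrow> scalar_field \<Rightarrow> planar_field \<Rightarrow> bool" where
  "weak_rot S u v \<longleftrightarrow> locally_integrable S u \<and>
     represents S (\<lambda>x. fst (v x)) (Dz (reg S u)) \<and>
     represents S (\<lambda>x. snd (v x)) (\<lambda>\<phi>. - D\<rho> (reg S u) \<phi>)"

definition weak_curl :: "point set \<Rightarrow> planar_field \<Rightarrow> scalar_field \<Rightarrow> bool" where
  "weak_curl S u c \<longleftrightarrow> locally_integrable S u \<and>
     represents S c (\<lambda>\<phi>. D\<rho> (reg S (\<lambda>x. snd (u x))) \<phi> - Dz (reg S (\<lambda>x. fst (u x))) \<phi>)"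

definition weak_div :: "point set \<Rightarrow> planar_field \<Rightarrow> scalar_field \<Rightarrow> bool" where
  "weak_div S u d \<longleftrightarrow> locally_integrable S u \<and>
     represents S d (\<lambda>\<phi>. D\<rho> (reg S (\<lambda>x. fst (u x))) \<phi> + Dz (reg S (\<lambda>x. snd (u x))) \<phi>)"

definition weak_gradm :: "int \<Rightarrow> point set \<Rightarrow> scalar_field \<Rightarrow> cyl_field \<Rightarrow> bool" where
  "weak_gradm m S u v \<longleftrightarrow> locally_integrable S u \<and>
     represents S (\<lambda>x. fst (v x)) (D\<rho> (reg S u)) \<and>
     represents S (\<lambda>x. fst (snd (v x))) (Dz (reg S u)) \<and>
     represents S (\<lambda>x. snd (snd (v x))) (mult (\<lambda>x. - of_int m / fst x) (reg S u))"

definition weak_curlm :: "int \<Rightarrow> point set \<Rightarrow> cyl_field \<Rightarrow> cyl_field \<Rightarrow> bool" where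
  "weak_curlm m S u w \<longleftrightarrow> locally_integrable S u \<and>
     (let u\<^sub>\<rho> = reg S (\<lambda>x. fst (u x));
          u\<^sub>z = reg S (\<lambda>x. fst (snd (u x)));
          u\<^sub>\<theta> = reg S (\<lambda>x. snd (snd (u x)))
      in represents S (\<lambda>x. fst (w x))
           (\<lambda>\<phi>. mult (\<lambda>x. - of_int m / fst x) u\<^sub>z \<phi> - Dz u\<^sub>\<theta> \<phi>) \<and>
         represents S (\<lambda>x. fst (snd (w x)))
           (mult (\<lambda>x. 1 / fst x) (\<lambda>\<phi>. D\<rho> (mult fst u\<^sub>\<theta>) \<phi> + of_int m * u\<^sub>\<rho> \<phi>)) \<and>
         represents S (\<lambda>x. snd (snd (w x)))
           (\<lambda>\<phi>. Dz u\<^sub>\<rho> \<phi> - D\<rho> u\<^sub>z \<phi>))"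

definition weak_divm :: "int \<Rightarrow> point set \<Rightarrow> cyl_field \<Rightarrow> scalar_field \<Rightarrow> bool" where
  "weak_divm m S u d \<longleftrightarrow> locally_integrable S u \<and>
     (let u\<^sub>\<rho> = reg S (\<lambda>x. fst (u x));
          u\<^sub>z = reg S (\<lambda>x. fst (snd (u x)));
          u\<^sub>\<theta> = reg S (\<lambda>x. snd (snd (u x)))
      in represents S d
           (\<lambda>\<phi>. mult (\<lambda>x. 1 / fst x) (D\<rho> (mult fst u\<^sub>\<rho>)) \<phi>
               - mult (\<lambda>x. of_int m / fst x) u\<^sub>\<theta> \<phi> + Dz u\<^sub>z \<phi>))"

text \<open>Images and kernels of such relations, restricted to a space \<open>V\<close>.\<close>

definition op_image :: "('a \<Rightarrow> 'b \<Rightarrow> bool) \<Rightarrow> 'a set \<Rightarrow> 'b set" where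
  "op_image R V = {v. \<exists>u\<in>V. R u v}"

definition op_kernel :: "('a \<Rightarrow> (point \<Rightarrow> 'b::zero) \<Rightarrow> bool) \<Rightarrow> 'a set \<Rightarrow> 'a set" where
  "op_kernel R V = {u\<in>V. R u (\<lambda>_. 0)}"

definition op_maps :: "('a \<Rightarrow> 'b \<Rightarrow> bool) \<Rightarrow> 'a set \<Rightarrow> 'b set \<Rightarrow> bool" where
  "op_maps R V W \<longleftrightarrow> (\<forall>u\<in>V. \<exists>v. R u v) \<and> op_image R V \<subseteq> W"

definition op_injective ::
  "point set \<Rightarrow> ((point \<Rightarrow> 'a) \<Rightarrow> 'b \<Rightarrow> bool) \<Rightarrow> (point \<Rightarrow> 'a) set \<Rightarrow> bool" where
  "op_injective S R V \<longleftrightarrow> (\<forall>u\<in>V. \<forall>u'\<in>V. \<forall>v. R u v \<and> R u' v \<longrightarrow> ae_eq S u u')"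


section \<open>Cartesian spaces\<close>

definition X0 :: "point set \<Rightarrow> scalar_field set" where
  "X0 S = {u \<in> L2 S. \<exists>g \<in> L2 S. weak_grad S u g}"

definition X1 :: "point set \<Rightarrow> planar_field set" where
  "X1 S = {u \<in> L2 S. \<exists>c \<in> L2 S. weak_curl S u c}"

definition X1s :: "point set \<Rightarrow> planar_field set" where
  "X1s S = {u \<in> L2 S. \<exists>d \<in> L2 S. weak_div S u d}"

definition X2 :: "point set \<Rightarrow> scalar_field set" where
  "X2 S = L2 S"

definition Prot :: "real \<times> real \<Rightarrow> real \<times> real" where
  "Prot = (\<lambda>(a, b). (b, - a))"

definition findim_subspace ::
  "point set \<Rightarrow> (point \<Rightarrow> 'b::euclidean_space) set \<Rightarrow> (point \<Rightarrow> 'b) set \<Rightarrow> bool" where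
  "findim_subspace S V X \<longleftrightarrow> V \<subseteq> X \<and>
     (\<lambda>_. 0) \<in> V \<and>
     (\<forall>u\<in>V. \<forall>v\<in>V. (\<lambda>x. u x + v x) \<in> V) \<and>
     (\<forall>a. \<forall>u\<in>V. (\<lambda>x. a *\<^sub>R u x) \<in> V) \<and>
     (\<forall>u\<in>V. \<forall>v. ae_eq S u v \<longrightarrow> v \<in> V) \<and>
     (\<exists>B. finite B \<and> B \<subseteq> V \<and> (\<forall>u\<in>V. \<exists>c. ae_eq S u (\<lambda>x. \<Sum>b\<in>B. c b *\<^sub>R b x)))"

definition discrete_spaces ::
  "point set \<Rightarrow> scalar_field set \<Rightarrow> planar_field set \<Rightarrow> planar_field set \<Rightarrow> scalar_field set \<Rightarrow> bool"
  where
  "discrete_spaces S X0h X1h X1sh X2h \<longleftrightarrow>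
     findim_subspace S X0h (X0 S) \<and> findim_subspace S X1h (X1 S) \<and>
     findim_subspace S X1sh (X1s S) \<and> findim_subspace S X2h (X2 S) \<and>
     op_image (weak_grad S) X0h \<subseteq> X1h \<and> op_image (weak_curl S) X1h \<subseteq> X2h \<and>
     op_image (weak_rot S) X0h \<subseteq> X1sh \<and> op_image (weak_div S) X1sh \<subseteq> X2h \<and>
     X1sh = (\<lambda>u. Prot \<circ> u) ` X1h"

text \<open>A linear projector onto \<open>V\<close>, acting on classes modulo null sets and bounded in \<open>L\<^sup>2\<close>.\<close>

definition L2_stable_projector ::
  "point set \<Rightarrow> ((point \<Rightarrow> 'b::euclidean_space) \<Rightarrow> (point \<Rightarrow> 'b)) \<Rightarrow>
   (point \<Rightarrow> 'b) set \<Rightarrow> (point \<Rightarrow> 'b) set \<Rightarrow> bool" where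
  "L2_stable_projector S p X V \<longleftrightarrow>
     p ` X \<subseteq> V \<and>
     (\<forall>u\<in>X. \<forall>v\<in>X. ae_eq S u v \<longrightarrow> ae_eq S (p u) (p v)) \<and>
     (\<forall>u\<in>X. \<forall>v\<in>X. \<forall>a b. ae_eq S (p (\<lambda>x. a *\<^sub>R u x + b *\<^sub>R v x)) (\<lambda>x. a *\<^sub>R p u x + b *\<^sub>R p v x)) \<and>
     (\<forall>u\<in>V. ae_eq S (p u) u) \<and>
     (\<exists>C. \<forall>u\<in>X. L2_norm S (p u) \<le> C * L2_norm S u)"

definition op_commutes ::
  "('a \<Rightarrow> 'b \<Rightarrow> bool) \<Rightarrow> ('a \<Rightarrow> 'a) \<Rightarrow> ('b \<Rightarrow> 'b) \<Rightarrow> 'a set \<Rightarrow> bool" where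
  "op_commutes R p q X \<longleftrightarrow> (\<forall>u\<in>X. \<forall>v. R u v \<longrightarrow> R (p u) (q v))"

definition commuting_projectors ::
  "point set \<Rightarrow> scalar_field set \<Rightarrow> planar_field set \<Rightarrow> planar_field set \<Rightarrow> scalar_field set \<Rightarrow>
   (scalar_field \<Rightarrow> scalar_field) \<Rightarrow> (planar_field \<Rightarrow> planar_field) \<Rightarrow>
   (planar_field \<Rightarrow> planar_field) \<Rightarrow> (scalar_field \<Rightarrow> scalar_field) \<Rightarrow> bool" where
  "commuting_projectors S X0h X1h X1sh X2h p0 p1 p1s p2 \<longleftrightarrow>
     L2_stable_projector S p0 (X0 S) X0h \<and> L2_stable_projector S p1 (X1 S) X1h \<and>
     L2_stable_projector S p1s (X1s S) X1sh \<and> L2_stable_projector S p2 (X2 S) X2h \<and>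
     op_commutes (weak_grad S) p0 p1 (X0 S) \<and> op_commutes (weak_curl S) p1 p2 (X1 S) \<and>
     op_commutes (weak_rot S) p0 p1s (X0 S) \<and> op_commutes (weak_div S) p1s p2 (X1s S)"


section \<open>Cylindrical discrete spaces\<close>

definition \<eta>0 :: "int \<Rightarrow> scalar_field \<Rightarrow> scalar_field" where
  "\<eta>0 m u = (\<lambda>x. of_int m / fst x * u x)"

definition \<eta>1 :: "int \<Rightarrow> cyl_field \<Rightarrow> cyl_field" where
  "\<eta>1 m u = (\<lambda>x. let (a, b, c) = u x in
     (1 / fst x * (of_int m * a + c), of_int m / fst x * b, c))"

definition \<eta>2 :: "int \<Rightarrow> cyl_field \<Rightarrow> cyl_field" where
  "\<eta>2 m u = (\<lambda>x. let (a, b, c) = u x in (a, b, 1 / fst x * (of_int m * c - a)))"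

definition \<eta>3 :: "int \<Rightarrow> scalar_field \<Rightarrow> scalar_field" where
  "\<eta>3 m u = u"

definition \<eta>0_inv :: "int \<Rightarrow> scalar_field \<Rightarrow> scalar_field" where
  "\<eta>0_inv m u = (\<lambda>x. fst x / of_int m * u x)"

definition \<eta>1_inv :: "int \<Rightarrow> cyl_field \<Rightarrow> cyl_field" where
  "\<eta>1_inv m u = (\<lambda>x. let (a, b, c) = u x in
     (1 / of_int m * (fst x * a - c), fst x / of_int m * b, c))"

definition \<eta>2_inv :: "int \<Rightarrow> cyl_field \<Rightarrow> cyl_field" where
  "\<eta>2_inv m u = (\<lambda>x. let (a, b, c) = u x in (a, b, 1 / of_int m * (fst x * c + a)))"

definition \<eta>3_inv :: "int \<Rightarrow> scalar_field \<Rightarrow> scalar_field" where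
  "\<eta>3_inv m u = u"

lemma \<eta>_inverse:
  assumes "m \<noteq> 0" "fst x \<noteq> 0"
  shows "\<eta>0_inv m (\<eta>0 m u) x = u x" "\<eta>0 m (\<eta>0_inv m u) x = u x"
    and "\<eta>1_inv m (\<eta>1 m w) x = w x" "\<eta>1 m (\<eta>1_inv m w) x = w x"
    and "\<eta>2_inv m (\<eta>2 m w) x = w x" "\<eta>2 m (\<eta>2_inv m w) x = w x"
    and "\<eta>3_inv m (\<eta>3 m u) x = u x" "\<eta>3 m (\<eta>3_inv m u) x = u x"
  using assms
  by (auto simp: \<eta>0_def \<eta>0_inv_def \<eta>1_def \<eta>1_inv_def \<eta>2_def \<eta>2_inv_def \<eta>3_def \<eta>3_inv_def
      field_simps split: prod.splits)

definition field_product :: "planar_field set \<Rightarrow> scalar_field set \<Rightarrow> cyl_field set" where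
  "field_product V W = {u. (\<lambda>x. (fst (u x), fst (snd (u x)))) \<in> V \<and> (\<lambda>x. snd (snd (u x))) \<in> W}"

text \<open>The image has to be closed under \<^term>\<open>ae_eq S\<close> by hand: the formulas for \<open>\<eta>_inv\<close> constrain
  the values on the axis \<open>\<rho> = 0\<close>, outside \<open>S\<close>.\<close>

definition ae_image ::
  "point set \<Rightarrow> ((point \<Rightarrow> 'a) \<Rightarrow> (point \<Rightarrow> 'b)) \<Rightarrow> (point \<Rightarrow> 'a) set \<Rightarrow> (point \<Rightarrow> 'b) set" where
  "ae_image S f V = {v. \<exists>u\<in>V. ae_eq S v (f u)}"

definition Z0h :: "int \<Rightarrow> point set \<Rightarrow> scalar_field set \<Rightarrow> scalar_field set" where
  "Z0h m S X0h = ae_image S (\<eta>0_inv m) X0h"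

definition Z1h :: "int \<Rightarrow> point set \<Rightarrow> planar_field set \<Rightarrow> scalar_field set \<Rightarrow> cyl_field set" where
  "Z1h m S X1h X0h = ae_image S (\<eta>1_inv m) (field_product X1h X0h)"

definition Z2h :: "int \<Rightarrow> point set \<Rightarrow> planar_field set \<Rightarrow> scalar_field set \<Rightarrow> cyl_field set" where
  "Z2h m S X1sh X2h = ae_image S (\<eta>2_inv m) (field_product X1sh X2h)"

definition Z3h :: "int \<Rightarrow> point set \<Rightarrow> scalar_field set \<Rightarrow> scalar_field set" where
  "Z3h m S X2h = ae_image S (\<eta>3_inv m) X2h"

end

theory Submission
  imports Defs
begin

text \<open>
  In the Cartesian unknowns the sequence has constant coefficients. Writing the cylindrical fields as
  \<open>\<eta>0_inv m t\<close>, \<open>\<eta>1_inv m (w, t)\<close> and \<open>\<eta>2_inv m (v, d)\<close>, with the planar part in the first place, the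
  three operators become
    \<^item> \<open>t \<mapsto> (grad t, - t)\<close>,
    \<^item> \<open>(w, t) \<mapsto> (- P (grad t + w), - curl w)\<close>,
    \<^item> \<open>(v, d) \<mapsto> div v - d\<close>,
  and neither \<open>\<rho>\<close> nor \<open>m\<close> is left (\<open>weak_gradm_iff\<close>, \<open>weak_curlm_iff\<close>, \<open>weak_divm_iff\<close>).

  Each of these maps has an invertible term of order zero, so exactness is pure algebra. The first one is
  injective because of its second component. If \<open>P (grad t + w) = 0\<close> then \<open>w = grad (- t)\<close>, so \<open>(w, t)\<close>
  is the image of \<open>- t\<close>. If \<open>div v = d\<close>, write \<open>v = P w\<close>; then \<open>curl w = div v = d\<close>, and \<open>(v, d)\<close> is the image
  of \<open>(- w, 0)\<close>. Finally \<open>d\<close> is the image of \<open>(0, - d)\<close>. All these witnesses lie in the discrete spaces, because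
  the spaces are linear, \<open>X\<^sub>h\<^sup>1\<^sup>* = P X\<^sub>h\<^sup>1\<close>, \<open>grad X\<^sub>h\<^sup>0 \<subseteq> X\<^sub>h\<^sup>1\<close> and \<open>curl X\<^sub>h\<^sup>1 \<subseteq> X\<^sub>h\<^sup>2\<close>.

  The analysis lies in the three formulas, since the operators act weakly and on representatives.
  That the right-hand sides are weak derivatives follows from the product rule, with the weight
  \<open>\<rho>\<close> moved onto the test function. That they are the only ones, up to null sets, is the fundamental
  lemma of the calculus of variations. The composition \<open>curl grad\<close> vanishes because the second
  derivatives of test functions commute.
\<close>

section \<open>Smooth functions and test functions\<close>

lemma partial_deriv_eq:
  assumes "(f has_derivative f') (at x)"
  shows "partial_deriv i f x = f' i"
  using frechet_derivative_at[OF assms] by (simp add: partial_deriv_def)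

lemma has_derivative_partial:
  assumes "f differentiable (at x)"
  shows "(f has_derivative (\<lambda>h. frechet_derivative f (at x) h)) (at x)"
  using assms frechet_derivative_works by blast

lemma Ck_SucI:
  assumes "\<And>x. (f has_derivative f' x) (at x)" "\<And>i. i \<in> Basis \<Longrightarrow> Ck k (\<lambda>x. f' x i)"
  shows "Ck (Suc k) f"
proof -
  have "partial_deriv i f = (\<lambda>x. f' x i)" for i
    using partial_deriv_eq[OF assms(1)] by blast
  then show ?thesis
    using assms by (metis Ck.simps(2) differentiable_def)
qed

lemma Ck_SucD_differentiable: "Ck (Suc k) f \<Longrightarrow> f differentiable (at x)"
  and Ck_SucD_partial: "Ck (Suc k) f \<Longrightarrow> i \<in> Basis \<Longrightarrow> Ck k (partial_deriv i f)"
  by (simp_all del: split_paired_All)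

lemma Ck_continuous: "Ck k f \<Longrightarrow> continuous_on UNIV f"
proof (cases k)
  case (Suc j)
  moreover assume "Ck k f"
  ultimately show ?thesis
    by (metis Ck_SucD_differentiable continuous_at_imp_continuous_on differentiable_imp_continuous_within)
qed simp

lemma Ck_SucD: "Ck (Suc k) f \<Longrightarrow> Ck k f"
proof (induction k arbitrary: f)
  case 0
  then show ?case using Ck_continuous[of "Suc 0" f] by simp
next
  case (Suc k)
  then show ?case by (metis Ck.simps(2))
qed

lemma Ck_const: "Ck k (\<lambda>_. c)"
proof (induction k arbitrary: c)
  case (Suc k)
  show ?case
    by (rule Ck_SucI[where f' = "\<lambda>_ _. 0"]) (auto intro: Suc)
qed (simp add: continuous_intros)

lemma Ck_fst: "Ck k (fst :: point \<Rightarrow> real)"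
proof (cases k)
  case (Suc j)
  then show ?thesis
    using Ck_SucI[of fst "\<lambda>_. fst" j] Ck_const
    by (simp add: has_derivative_fst del: Ck.simps)
qed (simp add: continuous_intros)

lemma Ck_add: "Ck k f \<Longrightarrow> Ck k g \<Longrightarrow> Ck k (\<lambda>x. f x + g x)"
proof (induction k arbitrary: f g)
  case (Suc k)
  show ?case
  proof (rule Ck_SucI)
    show "((\<lambda>x. f x + g x) has_derivative
        (\<lambda>h. frechet_derivative f (at x) h + frechet_derivative g (at x) h)) (at x)" for x
      using Suc.prems by (intro has_derivative_add has_derivative_partial Ck_SucD_differentiable)
    show "Ck k (\<lambda>x. frechet_derivative f (at x) i + frechet_derivative g (at x) i)" if "i \<in> Basis" for i
      unfolding partial_deriv_def[symmetric]
      using Suc.prems that by (intro Suc.IH Ck_SucD_partial)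
  qed
qed (simp add: continuous_on_add continuous_on_mult)

lemma Ck_mult: "Ck k f \<Longrightarrow> Ck k g \<Longrightarrow> Ck k (\<lambda>x. f x * g x)"
proof (induction k arbitrary: f g)
  case (Suc k)
  show ?case
  proof (rule Ck_SucI)
    show "((\<lambda>x. f x * g x) has_derivative
        (\<lambda>h. f x * frechet_derivative g (at x) h + frechet_derivative f (at x) h * g x)) (at x)" for x
      using Suc.prems by (intro has_derivative_mult has_derivative_partial Ck_SucD_differentiable)
    show "Ck k (\<lambda>x. f x * frechet_derivative g (at x) i + frechet_derivative f (at x) i * g x)"
      if "i \<in> Basis" for i
      unfolding partial_deriv_def[symmetric]
      using Suc.prems that by (intro Ck_add Suc.IH Ck_SucD_partial) (auto dest: Ck_SucD simp del: Ck.simps)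
  qed
qed (simp add: continuous_on_add continuous_on_mult)

lemma test_differentiable: "\<phi> \<in> test_functions S \<Longrightarrow> \<phi> differentiable (at x)"
  by (metis (mono_tags, lifting) Ck.simps(2) mem_Collect_eq test_functions_def)

lemma test_supported_subset:
  assumes "\<phi> \<in> test_functions S" "\<And>k. Ck k \<psi>" "{x. \<psi> x \<noteq> 0} \<subseteq> closure {x. \<phi> x \<noteq> 0}"
  shows "\<psi> \<in> test_functions S"
proof -
  have "closure {x. \<psi> x \<noteq> 0} \<subseteq> closure {x. \<phi> x \<noteq> 0}"
    using assms(3) by (simp add: closure_minimal)
  moreover from this have "compact (closure {x. \<psi> x \<noteq> 0})"
    using assms(1) by (metis (mono_tags, lifting) closed_closure compact_Int_closed inf.absorb_iff2
        mem_Collect_eq test_functions_def)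
  ultimately show ?thesis
    using assms(1,2) by (auto simp: test_functions_def)
qed

lemma test_partial_deriv:
  assumes "\<phi> \<in> test_functions S" "i \<in> Basis"
  shows "partial_deriv i \<phi> \<in> test_functions S"
proof (rule test_supported_subset[OF assms(1)])
  show "Ck k (partial_deriv i \<phi>)" for k
    using assms by (auto simp: test_functions_def dest!: spec[of _ "Suc k"])
  have "partial_deriv i \<phi> x = 0" if "x \<notin> closure {x. \<phi> x \<noteq> 0}" for x
  proof -
    have "((\<lambda>_. 0) has_derivative (\<lambda>_. 0)) (at x)"
      by simp
    then have "(\<phi> has_derivative (\<lambda>_. 0)) (at x)"
      by (rule has_derivative_transform_within_open[of _ _ _ _ "- closure {x. \<phi> x \<noteq> 0}"])
         (use that closure_subset[of "{x. \<phi> x \<noteq> 0}"] in auto)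
    then show ?thesis by (rule partial_deriv_eq)
  qed
  then show "{x. partial_deriv i \<phi> x \<noteq> 0} \<subseteq> closure {x. \<phi> x \<noteq> 0}"
    by blast
qed

lemma test_mult_fst:
  assumes "\<phi> \<in> test_functions S"
  shows "(\<lambda>x. fst x * \<phi> x) \<in> test_functions S"
proof (rule test_supported_subset[OF assms])
  show "Ck k (\<lambda>x. fst x * \<phi> x)" for k
    using assms by (intro Ck_mult Ck_fst) (auto simp: test_functions_def)
  show "{x. fst x * \<phi> x \<noteq> 0} \<subseteq> closure {x. \<phi> x \<noteq> 0}"
    using closure_subset by fastforce
qed

text \<open>
  The second difference is symmetric in the directions \<open>i\<close> and \<open>j\<close>, whereas two applications of the
  mean value theorem express it through the derivatives taken in a chosen order. Comparing both orders for
  \<open>h \<rightarrow> 0\<close> gives the symmetry of the second derivatives.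
\<close>

lemma second_difference_mean_value:
  fixes f :: scalar_field
  assumes f: "\<And>x. f differentiable (at x)" "\<And>x. partial_deriv i f differentiable (at x)" and "h > 0"
  obtains q where "norm (q - p) \<le> h * (norm i + norm j)"
    "f (p + h *\<^sub>R i + h *\<^sub>R j) - f (p + h *\<^sub>R i) - f (p + h *\<^sub>R j) + f p
      = h * h * partial_deriv j (partial_deriv i f) q"
proof -
  have line: "((\<lambda>s. g (a + s *\<^sub>R b)) has_real_derivative partial_deriv b g (a + s *\<^sub>R b)) (at s)"
    if "\<And>x. g differentiable (at x)" for g :: scalar_field and a b s
  proof -
    have "((\<lambda>s. a + s *\<^sub>R b) has_derivative (\<lambda>t. t *\<^sub>R b)) (at s)"
      by (auto intro!: derivative_eq_intros)
    then have "((\<lambda>s. g (a + s *\<^sub>R b)) has_derivative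
        (\<lambda>t. frechet_derivative g (at (a + s *\<^sub>R b)) (t *\<^sub>R b))) (at s)"
      by (rule has_derivative_compose[OF _ has_derivative_partial[OF that]])
    moreover have "(\<lambda>t. frechet_derivative g (at (a + s *\<^sub>R b)) (t *\<^sub>R b))
        = (*) (partial_deriv b g (a + s *\<^sub>R b))"
      using linear_frechet_derivative[OF that] by (auto simp: partial_deriv_def linear_scale)
    ultimately show ?thesis by (simp add: has_field_derivative_def)
  qed
  obtain s where s: "0 < s" "s < h" and
    "(f ((p + h *\<^sub>R j) + h *\<^sub>R i) - f (p + h *\<^sub>R i)) - (f ((p + h *\<^sub>R j) + 0 *\<^sub>R i) - f (p + 0 *\<^sub>R i))
      = (h - 0) * (partial_deriv i f ((p + h *\<^sub>R j) + s *\<^sub>R i) - partial_deriv i f (p + s *\<^sub>R i))"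
    using MVT2[of 0 h "\<lambda>s. f ((p + h *\<^sub>R j) + s *\<^sub>R i) - f (p + s *\<^sub>R i)"
        "\<lambda>s. partial_deriv i f ((p + h *\<^sub>R j) + s *\<^sub>R i) - partial_deriv i f (p + s *\<^sub>R i)"]
      \<open>h > 0\<close> DERIV_diff[OF line[OF f(1)] line[OF f(1)]] by auto
  moreover obtain t where t: "0 < t" "t < h" and
    "partial_deriv i f ((p + s *\<^sub>R i) + h *\<^sub>R j) - partial_deriv i f ((p + s *\<^sub>R i) + 0 *\<^sub>R j)
      = (h - 0) * partial_deriv j (partial_deriv i f) ((p + s *\<^sub>R i) + t *\<^sub>R j)"
    using MVT2[of 0 h "\<lambda>t. partial_deriv i f ((p + s *\<^sub>R i) + t *\<^sub>R j)"
        "\<lambda>t. partial_deriv j (partial_deriv i f) ((p + s *\<^sub>R i) + t *\<^sub>R j)"]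
      \<open>h > 0\<close> line[OF f(2)] by auto
  ultimately have eq: "f (p + h *\<^sub>R i + h *\<^sub>R j) - f (p + h *\<^sub>R i) - f (p + h *\<^sub>R j) + f p
      = h * h * partial_deriv j (partial_deriv i f) (p + s *\<^sub>R i + t *\<^sub>R j)"
    by (simp add: add_ac algebra_simps)
  have "norm ((p + s *\<^sub>R i + t *\<^sub>R j) - p) \<le> s * norm i + t * norm j"
    using norm_triangle_ineq[of "s *\<^sub>R i" "t *\<^sub>R j"] s t by simp
  also have "\<dots> \<le> h * (norm i + norm j)"
    using s t by (simp add: distrib_left add_mono mult_right_mono)
  finally show thesis using that eq by blast
qed

lemma partial_deriv_commute:
  fixes f :: scalar_field
  assumes "Ck 2 f" "i \<in> Basis" "j \<in> Basis"
  shows "partial_deriv i (partial_deriv j f) = partial_deriv j (partial_deriv i f)"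
proof (rule ccontr)
  let ?A = "partial_deriv i (partial_deriv j f)" and ?B = "partial_deriv j (partial_deriv i f)"
  assume "?A \<noteq> ?B"
  then obtain p where p: "?A p \<noteq> ?B p" by blast
  define e where "e = \<bar>?A p - ?B p\<bar> / 2"
  have e: "e > 0" using p by (simp add: e_def)
  have Ck1: "Ck 1 (partial_deriv i f)" "Ck 1 (partial_deriv j f)"
    using assms by (auto simp: numeral_2_eq_2)
  have d: "f differentiable (at x)" "partial_deriv i f differentiable (at x)"
    "partial_deriv j f differentiable (at x)" for x
    using assms(1) Ck1 by (auto simp: numeral_2_eq_2 simp del: split_paired_All)
  have c: "continuous_on UNIV ?A" "continuous_on UNIV ?B"
    using Ck1 assms by auto
  obtain d1 where d1: "d1 > 0" "\<And>q. dist q p < d1 \<Longrightarrow> dist (?A q) (?A p) < e"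
    using c(1) e by (meson UNIV_I continuous_on_iff)
  obtain d2 where d2: "d2 > 0" "\<And>q. dist q p < d2 \<Longrightarrow> dist (?B q) (?B p) < e"
    using c(2) e by (meson UNIV_I continuous_on_iff)
  \<comment> \<open>Basis vectors have norm 1, so both intermediate points are within \<open>2 * h\<close> of \<open>p\<close>.\<close>
  define h where "h = min d1 d2 / 4"
  have h: "h > 0" "h * (norm i + norm j) < d1" "h * (norm i + norm j) < d2"
    using d1 d2 assms by (auto simp: h_def)
  obtain q where q: "norm (q - p) \<le> h * (norm i + norm j)"
    "f (p + h *\<^sub>R i + h *\<^sub>R j) - f (p + h *\<^sub>R i) - f (p + h *\<^sub>R j) + f p = h * h * ?B q"
    using second_difference_mean_value[OF d(1,2) h(1)] .
  obtain r where r: "norm (r - p) \<le> h * (norm j + norm i)"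
    "f (p + h *\<^sub>R j + h *\<^sub>R i) - f (p + h *\<^sub>R j) - f (p + h *\<^sub>R i) + f p = h * h * ?A r"
    using second_difference_mean_value[OF d(1,3) h(1)] .
  have "h * h * ?A r = h * h * ?B q"
    unfolding q(2)[symmetric] r(2)[symmetric] by (simp add: add_ac)
  then have "?A r = ?B q"
    using h(1) by simp
  moreover have "dist (?B q) (?B p) < e" "dist (?A r) (?A p) < e"
    using d1(2)[of r] d2(2)[of q] q(1) r(1) h by (simp_all add: dist_norm add.commute)
  ultimately show False
    unfolding e_def dist_real_def by (simp add: abs_if split: if_splits)
qed

section \<open>Equality up to null sets and local integrability\<close>

lemma ae_eq_iff_negligible:
  assumes "S \<in> sets lebesgue"
  shows "ae_eq S u v \<longleftrightarrow> (\<exists>N. negligible N \<and> (\<forall>x\<in>S - N. u x = v x))"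
proof -
  have "ae_eq S u v \<longleftrightarrow> (AE x in lebesgue. x \<in> S \<longrightarrow> u x = v x)"
    using assms by (simp add: ae_eq_def AE_restrict_space_iff)
  also have "\<dots> \<longleftrightarrow> {x. \<not> (x \<in> S \<longrightarrow> u x = v x)} \<in> null_sets lebesgue"
    by (simp add: completion.AE_iff_null_sets)
  also have "\<dots> \<longleftrightarrow> (\<exists>N. negligible N \<and> (\<forall>x\<in>S - N. u x = v x))"
    unfolding negligible_iff_null_sets[symmetric]
  proof
    assume "negligible {x. \<not> (x \<in> S \<longrightarrow> u x = v x)}"
    then show "\<exists>N. negligible N \<and> (\<forall>x\<in>S - N. u x = v x)" by blast
  next
    assume "\<exists>N. negligible N \<and> (\<forall>x\<in>S - N. u x = v x)"
    then show "negligible {x. \<not> (x \<in> S \<longrightarrow> u x = v x)}"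
      by (smt (verit, ccfv_SIG) Diff_iff mem_Collect_eq negligible_subset subsetI)
  qed
  finally show ?thesis .
qed

lemma ae_eq_refl: "ae_eq S u u"
  by (simp add: ae_eq_def)

lemma ae_eq_map:
  assumes "ae_eq S u v" "\<And>x. x \<in> S \<Longrightarrow> u x = v x \<Longrightarrow> u' x = v' x"
  shows "ae_eq S u' v'"
  using AE_space[of "lebesgue_on S"] assms(1) unfolding ae_eq_def
  by eventually_elim (use assms(2) in auto)

lemma ae_eq_map2:
  assumes "ae_eq S u v" "ae_eq S u' v'"
    "\<And>x. x \<in> S \<Longrightarrow> u x = v x \<Longrightarrow> u' x = v' x \<Longrightarrow> w x = w' x"
  shows "ae_eq S w w'"
  using AE_space[of "lebesgue_on S"] assms(1,2) unfolding ae_eq_def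
  by eventually_elim (use assms(3) in auto)

lemma ae_eq_sym: "ae_eq S u v \<Longrightarrow> ae_eq S v u"
  by (erule ae_eq_map) simp

lemma ae_eq_trans: "ae_eq S u v \<Longrightarrow> ae_eq S v w \<Longrightarrow> ae_eq S u w"
  by (erule ae_eq_map2, assumption) simp

lemma compact_in_sets_lebesgue: "compact K \<Longrightarrow> K \<in> sets lebesgue" for K :: "point set"
  by (simp add: compact_imp_closed lborelD)

lemma integrable_compact_support:
  fixes g :: "point \<Rightarrow> real"
  assumes S: "S \<in> sets lebesgue" and K: "K \<subseteq> S" and 0: "\<And>x. x \<in> S - K \<Longrightarrow> g x = 0"
    and g: "g absolutely_integrable_on K"
  shows "integrable (lebesgue_on S) g" "integral\<^sup>L (lebesgue_on S) g = integral K g"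
proof -
  have eq: "(\<lambda>x. indicator S x *\<^sub>R g x) = (\<lambda>x. indicator K x *\<^sub>R g x)"
    using K 0 by (force simp: indicator_def)
  show "integrable (lebesgue_on S) g"
    using g S by (simp add: integrable_restrict_space set_integrable_def eq del: real_scaleR_def)
  have "integral\<^sup>L (lebesgue_on S) g = (LINT x:K|lebesgue. g x)"
    using S by (simp add: integral_restrict_space set_lebesgue_integral_def eq del: real_scaleR_def)
  then show "integral\<^sup>L (lebesgue_on S) g = integral K g"
    using set_lebesgue_integral_eq_integral(2)[OF g] by simp
qed

lemma locally_integrable_cong:
  assumes "S \<in> sets lebesgue" "locally_integrable S u" "ae_eq S u v"
  shows "locally_integrable S v"
proof -
  obtain N where N: "negligible N" "\<forall>x\<in>S - N. u x = v x"
    using assms by (auto simp: ae_eq_iff_negligible[OF assms(1)])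
  have "v absolutely_integrable_on K" if K: "compact K \<and> K \<subseteq> S" for K
  proof (rule absolutely_integrable_spike[OF _ N(1)])
    show "u absolutely_integrable_on K"
      using assms(2) K by (simp add: locally_integrable_def)
    show "v x = u x" if "x \<in> K - N" for x
      using that K N(2) by auto
  qed
  then show ?thesis
    by (simp add: locally_integrable_def)
qed

lemma locally_integrable_linear:
  "locally_integrable S u \<Longrightarrow> bounded_linear L \<Longrightarrow> locally_integrable S (\<lambda>x. L (u x))"
  using absolutely_integrable_linear[where f = u and h = L] by (simp add: locally_integrable_def comp_def)

lemma locally_integrable_add:
  "locally_integrable S u \<Longrightarrow> locally_integrable S v \<Longrightarrow> locally_integrable S (\<lambda>x. u x + v x)"
  unfolding locally_integrable_def by (simp add: set_integral_add(1))

lemma locally_integrable_diff: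
  "locally_integrable S u \<Longrightarrow> locally_integrable S v \<Longrightarrow> locally_integrable S (\<lambda>x. u x - v x)"
  unfolding locally_integrable_def by (simp add: set_integral_diff(1))

lemmas locally_integrable_fst = locally_integrable_linear[OF _ bounded_linear_fst]
  and locally_integrable_snd = locally_integrable_linear[OF _ bounded_linear_snd]

lemma locally_integrable_Pair:
  assumes "locally_integrable S u" "locally_integrable S v"
  shows "locally_integrable S (\<lambda>x. (u x, v x))"
proof -
  have "bounded_linear (\<lambda>a::'a. (a, 0::'b))" "bounded_linear (\<lambda>b::'b. (0::'a, b))"
    by (auto intro!: bounded_linear_Pair bounded_linear_ident bounded_linear_zero)
  from locally_integrable_add[OF locally_integrable_linear[OF assms(1) this(1)]
      locally_integrable_linear[OF assms(2) this(2)]]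
  show ?thesis by simp
qed

lemma absolutely_integrable_times_continuous:
  fixes f :: scalar_field
  assumes "f absolutely_integrable_on K" "compact K" "continuous_on K a"
  shows "(\<lambda>x. a x * f x) absolutely_integrable_on K"
proof -
  have K: "K \<in> sets lebesgue"
    using compact_in_sets_lebesgue[OF assms(2)] .
  have "a \<in> borel_measurable (lebesgue_on K)"
    using continuous_imp_measurable_on_sets_lebesgue[OF assms(3) K] .
  moreover have "bounded (a ` K)"
    using assms(2,3) compact_imp_bounded compact_continuous_image by blast
  ultimately show ?thesis
    using absolutely_integrable_bounded_measurable_product[OF bilinear_times _ K _ assms(1)] by blast
qed

lemma locally_integrable_times:
  fixes f :: scalar_field
  assumes "locally_integrable S f" "continuous_on S a"
  shows "locally_integrable S (\<lambda>x. a x * f x)"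
  using assms continuous_on_subset[OF assms(2)]
  by (simp add: locally_integrable_def absolutely_integrable_times_continuous)

lemma locally_integrable_const_times:
  "locally_integrable S f \<Longrightarrow> locally_integrable S (\<lambda>x. (c :: real) * f x)"
  by (intro locally_integrable_times continuous_on_const)

lemma L2_locally_integrable:
  fixes f :: scalar_field
  assumes S: "S \<in> sets lebesgue" and f: "f \<in> L2 S"
  shows "locally_integrable S f"
  unfolding locally_integrable_def
proof (intro allI impI)
  fix K assume K: "compact K \<and> K \<subseteq> S"
  then have KS: "K \<in> sets lebesgue" using compact_in_sets_lebesgue by blast
  have meas: "f \<in> borel_measurable (lebesgue_on K)"
    using f K S KS by (auto simp: L2_def intro: measurable_restrict_mono)
  have "set_integrable lebesgue S (\<lambda>x. (norm (f x))\<^sup>2)"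
    using f S by (simp add: L2_def integrable_restrict_space set_integrable_def)
  then have "set_integrable lebesgue K (\<lambda>x. (norm (f x))\<^sup>2)"
    using K KS by (meson set_integrable_subset)
  moreover have "set_integrable lebesgue K (\<lambda>x. 1::real)"
    using K by (simp add: absolutely_integrable_on_const lmeasurable_compact)
  ultimately have "(\<lambda>x. (norm (f x))\<^sup>2 + 1) absolutely_integrable_on K"
    by (rule set_integral_add(1))
  then have "(\<lambda>x. (norm (f x))\<^sup>2 + 1) integrable_on K"
    using set_lebesgue_integral_eq_integral(1) by blast
  then show "f absolutely_integrable_on K"
  proof (rule measurable_bounded_by_integrable_imp_absolutely_integrable[OF meas KS])
    show "norm (f x) \<le> (norm (f x))\<^sup>2 + 1" for x
      using sum_squares_bound[of "norm (f x)" 1] norm_ge_zero[of "f x"]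
      by (simp del: norm_ge_zero)
  qed
qed

lemma integrable_times_test:
  assumes S: "S \<in> sets lebesgue" and f: "locally_integrable S f" and \<phi>: "\<phi> \<in> test_functions S"
  shows "integrable (lebesgue_on S) (\<lambda>x. f x * \<phi> x)"
proof (rule integrable_compact_support(1)[OF S])
  let ?K = "closure {x. \<phi> x \<noteq> 0}"
  have K: "compact ?K" "?K \<subseteq> S" and c: "continuous_on UNIV \<phi>"
    using \<phi> Ck_continuous by (auto simp: test_functions_def)
  show "?K \<subseteq> S" by fact
  show "f x * \<phi> x = 0" if "x \<in> S - ?K" for x
    using that closure_subset[of "{x. \<phi> x \<noteq> 0}"] by auto
  show "(\<lambda>x. f x * \<phi> x) absolutely_integrable_on ?K"
    using absolutely_integrable_times_continuous[where f = f and K = ?K and a = \<phi>] K c f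
    by (simp add: locally_integrable_def mult.commute continuous_on_subset)
qed

section \<open>The fundamental lemma of the calculus of variations\<close>

text \<open>
  The family of all \<open>p (1 / t) * exp (- 1 / t)\<close>, extended by zero to \<open>t \<le> 0\<close>, is closed under differentiation, so
  that all its members are smooth. The classical cut-off is \<open>flat 1\<close>.
\<close>

definition flat :: "real poly \<Rightarrow> real \<Rightarrow> real" where
  "flat p t = (if t > 0 then poly p (1 / t) * exp (- (1 / t)) else 0)"

lemma poly_times_exp_tendsto_0: "((\<lambda>t. poly p t * exp (- t)) \<longlongrightarrow> (0::real)) at_top"
proof -
  have "((\<lambda>t. \<Sum>k\<le>degree p. coeff p k * (t ^ k / exp t)) \<longlongrightarrow> (\<Sum>k\<le>degree p. coeff p k * 0)) at_top"
    by (intro tendsto_intros tendsto_power_div_exp_0)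
  then show ?thesis
    by (simp add: poly_altdef sum_distrib_right exp_minus divide_inverse mult.assoc)
qed

lemma flat_quotient_tendsto_0: "((\<lambda>t. flat p t / t) \<longlongrightarrow> 0) (at 0)"
proof (rule filterlim_split_at)
  show "((\<lambda>t. flat p t / t) \<longlongrightarrow> 0) (at_left 0)"
    by (rule tendsto_eventually) (auto simp: flat_def eventually_at_left_field intro!: exI[of _ "-1"])
  have "((\<lambda>t. poly (pCons 0 p) (inverse t) * exp (- (inverse t))) \<longlongrightarrow> 0) (at_right 0)"
    by (rule filterlim_compose[OF poly_times_exp_tendsto_0 filterlim_inverse_at_top_right])
  then show "((\<lambda>t. flat p t / t) \<longlongrightarrow> 0) (at_right 0)"
    by (rule Lim_transform_eventually)
       (auto simp: flat_def eventually_at_right_field field_simps intro!: exI[of _ 1])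
qed

lemma flat_has_derivative:
  "(flat p has_real_derivative flat (pCons 0 (pCons 0 (p - pderiv p))) t) (at t)"
proof -
  consider "t > 0" | "t < 0" | "t = 0" by linarith
  then show ?thesis
  proof cases
    case 1
    have "((\<lambda>t. poly p (1 / t) * exp (- (1 / t))) has_real_derivative
        flat (pCons 0 (pCons 0 (p - pderiv p))) t) (at t)"
      using 1 by (auto intro!: derivative_eq_intros DERIV_chain2[of "poly p"] poly_DERIV
          simp: flat_def field_simps power2_eq_square)
    then show ?thesis
      by (rule has_field_derivative_transform_within_open[of _ _ _ "{0<..}"])
         (use 1 in \<open>auto simp: flat_def\<close>)
  next
    case 2
    have "((\<lambda>t. 0) has_real_derivative flat (pCons 0 (pCons 0 (p - pderiv p))) t) (at t)"
      using 2 by (simp add: flat_def)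
    then show ?thesis
      by (rule has_field_derivative_transform_within_open[of _ _ _ "{..<0}"])
         (use 2 in \<open>auto simp: flat_def\<close>)
  next
    case 3
    show ?thesis
      using flat_quotient_tendsto_0[of p] 3 by (simp add: has_field_derivative_iff flat_def)
  qed
qed

lemma Ck_flat_affine:
  fixes a :: real and l :: point
  shows "Ck k (\<lambda>x. flat p (l \<bullet> x + a))"
proof (induction k arbitrary: p)
  case 0
  have "continuous_on UNIV (flat p)"
    using flat_has_derivative by (meson DERIV_isCont continuous_at_imp_continuous_on)
  then show ?case
    by (auto intro!: continuous_on_compose2[of UNIV "flat p"] continuous_on_add continuous_on_inner
        continuous_on_id continuous_on_const)
next
  case (Suc k)
  let ?q = "pCons 0 (pCons 0 (p - pderiv p))"
  show ?case
  proof (rule Ck_SucI)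
    show "((\<lambda>x. flat p (l \<bullet> x + a)) has_derivative (\<lambda>h. (l \<bullet> h) * flat ?q (l \<bullet> x + a))) (at x)" for x
    proof -
      have "((\<lambda>x. l \<bullet> x + a) has_derivative (\<lambda>h. l \<bullet> h)) (at x)"
        by (auto intro!: derivative_eq_intros)
      from has_derivative_compose[OF this
          flat_has_derivative[of p "l \<bullet> x + a", unfolded has_field_derivative_def]]
      show ?thesis by (simp add: mult.commute)
    qed
    show "Ck k (\<lambda>x. (l \<bullet> i) * flat ?q (l \<bullet> x + a))" for i
      by (intro Ck_mult Ck_const Suc.IH)
  qed
qed

lemma flat_1_bounds: "0 \<le> flat 1 t" "flat 1 t \<le> 1"
  by (auto simp: flat_def)

text \<open>For \<open>t > 0\<close> the value at \<open>n * t\<close> is the \<open>n\<close>-th root of \<open>exp (- 1 / t)\<close>, which tends to 1.\<close>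

lemma flat_1_tendsto_indicator: "(\<lambda>n. flat 1 (real n * t)) \<longlonglongrightarrow> indicator {0<..} t"
proof (cases "t > 0")
  case True
  have "(\<lambda>n. exp (- (inverse (real n) / t))) \<longlonglongrightarrow> exp (- (0 / t))"
    using True by (intro tendsto_intros lim_inverse_n) auto
  moreover have "\<forall>\<^sub>F n in sequentially. exp (- (inverse (real n) / t)) = flat 1 (real n * t)"
    using eventually_gt_at_top[of 0]
    by eventually_elim (use True in \<open>auto simp: flat_def field_simps\<close>)
  ultimately show ?thesis
    using True by (simp add: Lim_transform_eventually)
next
  case False
  then have "flat 1 (real n * t) = 0" for n
    by (auto simp: flat_def zero_less_mult_iff)
  then show ?thesis using False by simp
qed

definition bump :: "nat \<Rightarrow> point \<Rightarrow> point \<Rightarrow> scalar_field" where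
  "bump n a b = (\<lambda>x. flat 1 (n * (fst x - fst a)) * flat 1 (n * (fst b - fst x)) *
     flat 1 (n * (snd x - snd a)) * flat 1 (n * (snd b - snd x)))"

lemma in_box_point: "(x :: point) \<in> box a b \<longleftrightarrow> fst a < fst x \<and> fst x < fst b \<and> snd a < snd x \<and> snd x < snd b"
  by (cases x; cases a; cases b) (auto simp: mem_box Basis_prod_def)

lemma bump_nonzero_in_box: "bump n a b x \<noteq> 0 \<Longrightarrow> x \<in> box a b"
  by (auto simp: bump_def flat_def in_box_point zero_less_mult_iff split: if_splits)

lemma bump_bounds: "0 \<le> bump n a b x" "bump n a b x \<le> 1"
  by (auto simp: bump_def intro!: mult_nonneg_nonneg mult_le_one flat_1_bounds)

lemma bump_tendsto_indicator: "(\<lambda>n. bump n a b x) \<longlonglongrightarrow> indicator (box a b) x"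
proof -
  have "indicator (box a b) x = indicator {0<..} (fst x - fst a) * indicator {0<..} (fst b - fst x) *
      indicator {0<..} (snd x - snd a) * (indicator {0<..} (snd b - snd x) :: real)"
    by (auto simp: in_box_point indicator_def)
  then show ?thesis
    unfolding bump_def by (auto intro!: tendsto_mult flat_1_tendsto_indicator)
qed

lemma bump_test:
  assumes "cbox a b \<subseteq> S"
  shows "bump n a b \<in> test_functions S"
proof -
  have "bump n a b = (\<lambda>x. flat 1 ((real n, 0) \<bullet> x + - (n * fst a)) *
     flat 1 ((- real n, 0) \<bullet> x + n * fst b) * flat 1 ((0, real n) \<bullet> x + - (n * snd a)) *
     flat 1 ((0, - real n) \<bullet> x + n * snd b))"
    by (auto simp: bump_def fun_eq_iff algebra_simps)
  then have "Ck k (bump n a b)" for k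
    by (simp only:) (intro Ck_mult Ck_flat_affine)
  moreover have cl: "closure {x. bump n a b x \<noteq> 0} \<subseteq> cbox a b"
    using bump_nonzero_in_box[of n a b] box_subset_cbox[of a b] by (intro closure_minimal) (auto simp del: split_paired_All)
  moreover have "compact (closure {x. bump n a b x \<noteq> 0})"
    by (metis cl bounded_cbox bounded_subset closed_closure compact_eq_bounded_closed)
  ultimately show ?thesis
    using assms by (auto simp: test_functions_def)
qed

text \<open>
  The bumps are test functions bounded by 1 that converge to the indicator of the open box, so
  dominated convergence carries the vanishing of the distribution over to the box.
\<close>

lemma integral_box_zero:
  assumes S: "S \<in> sets lebesgue" and f: "locally_integrable S f"
    and 0: "\<And>\<phi>. \<phi> \<in> test_functions S \<Longrightarrow> reg S f \<phi> = 0" and ab: "cbox a b \<subseteq> S"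
  shows "integral (cbox a b) f = 0"
proof -
  have fi: "f absolutely_integrable_on cbox a b"
    using f ab by (auto simp: locally_integrable_def)
  have fb: "f absolutely_integrable_on box a b"
    by (rule set_integrable_subset[OF fi]) (auto simp: box_subset_cbox)
  let ?w = "\<lambda>x. indicator (cbox a b) x * norm (f x)"
  have w: "integrable (lebesgue_on S) ?w"
  proof (rule integrable_compact_support(1)[OF S ab])
    show "?w absolutely_integrable_on cbox a b"
      by (rule absolutely_integrable_spike[OF absolutely_integrable_norm[OF fi], of "{}"])
         (auto simp: comp_def)
  qed auto
  let ?g = "\<lambda>x. f x * indicator (box a b) x"
  have gi: "?g absolutely_integrable_on box a b"
    by (rule absolutely_integrable_spike[OF fb, of "{}"]) auto
  have g: "integrable (lebesgue_on S) ?g" "integral\<^sup>L (lebesgue_on S) ?g = integral (box a b) ?g"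
    using integrable_compact_support[OF S _ _ gi] ab box_subset_cbox[of a b] by auto
  have "(\<lambda>n. reg S f (bump n a b)) \<longlonglongrightarrow> integral\<^sup>L (lebesgue_on S) ?g"
    unfolding reg_def
  proof (rule integral_dominated_convergence[OF _ _ w])
    show "?g \<in> borel_measurable (lebesgue_on S)"
      using g(1) by blast
    show "(\<lambda>x. f x * bump n a b x) \<in> borel_measurable (lebesgue_on S)" for n
      using integrable_times_test[OF S f bump_test[OF ab]] by blast
    show "AE x in lebesgue_on S. (\<lambda>n. f x * bump n a b x) \<longlonglongrightarrow> ?g x"
      by (auto intro!: always_eventually tendsto_mult bump_tendsto_indicator)
    show "AE x in lebesgue_on S. norm (f x * bump n a b x) \<le> ?w x" for n
    proof (rule always_eventually, rule allI)
      fix x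
      show "norm (f x * bump n a b x) \<le> ?w x"
      proof (cases "bump n a b x = 0")
        case False
        then have "x \<in> cbox a b"
          using bump_nonzero_in_box box_subset_cbox by blast
        then show ?thesis
          using bump_bounds[of n a b x] by (simp add: abs_mult mult_left_le)
      qed simp
    qed
  qed
  then have "integral\<^sup>L (lebesgue_on S) ?g = 0"
    using 0[OF bump_test[OF ab]] by (simp add: LIMSEQ_const_iff)
  then have "integral (box a b) ?g = 0"
    using g by simp
  moreover have "integral (box a b) ?g = integral (box a b) f"
    by (rule integral_cong) auto
  ultimately show ?thesis
    by (simp add: integral_open_interval)
qed

text \<open>
  Almost every value of a locally integrable function is the limit of its averages over small
  boxes, and these are zero. Countably many boxes with closure in \<open>S\<close> cover \<open>S\<close>.
\<close>

lemma fundamental_lemma_calculus_of_variations: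
  assumes S: "open S" and f: "locally_integrable S f"
    and 0: "\<And>\<phi>. \<phi> \<in> test_functions S \<Longrightarrow> reg S f \<phi> = 0"
  shows "ae_eq S f (\<lambda>_. 0)"
proof -
  have SL: "S \<in> sets lebesgue" using S by (simp add: borel_open)
  have local: "\<exists>N. negligible N \<and> (\<forall>x\<in>box a b - N. f x = 0)" if ab: "cbox a b \<subseteq> S" for a b
  proof -
    define g where "g = (\<lambda>x. if x \<in> cbox a b then f x else 0)"
    have "f absolutely_integrable_on cbox a b"
      using f ab by (auto simp: locally_integrable_def)
    then have "f integrable_on cbox a b"
      using set_lebesgue_integral_eq_integral(1) by blast
    then have "g integrable_on UNIV"
      unfolding g_def by (simp add: integrable_restrict_UNIV)
    then have "g integrable_on cbox c d" for c d
      by (rule integrable_on_subcbox) simp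
    then obtain N where N: "negligible N"
      "\<And>x e. \<lbrakk>x \<notin> N; 0 < e\<rbrakk> \<Longrightarrow> \<exists>d>0. \<forall>h. 0 < h \<and> h < d \<longrightarrow>
         norm (integral (cbox x (x + h *\<^sub>R One)) g /\<^sub>R h ^ DIM(point) - g x) < e"
      using integrable_ccontinuous_explicit[of g] by blast
    have "f x = 0" if x: "x \<in> box a b - N" for x
    proof (rule ccontr)
      assume "f x \<noteq> 0"
      then have "norm (f x) > 0" by simp
      then obtain d where d: "d > 0" "\<And>h. 0 < h \<Longrightarrow> h < d \<Longrightarrow>
         norm (integral (cbox x (x + h *\<^sub>R One)) g /\<^sub>R h ^ DIM(point) - g x) < norm (f x)"
        using N(2)[of x "norm (f x)"] x by blast
      define h where "h = min d (min (fst b - fst x) (snd b - snd x)) / 2"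
      have h: "0 < h" "h < d" "h < fst b - fst x" "h < snd b - snd x"
        using d(1) x by (auto simp: h_def in_box_point)
      have One: "(One :: point) = (1, 1)"
        by (simp add: sum_Basis_prod_eq)
      have sub: "cbox x (x + h *\<^sub>R One) \<subseteq> cbox a b"
        using h x unfolding One
        by (cases x; cases a; cases b) (auto simp: mem_box Basis_prod_def)
      have "integral (cbox x (x + h *\<^sub>R One)) g = integral (cbox x (x + h *\<^sub>R One)) f"
        using sub by (intro integral_cong) (auto simp: g_def)
      also have "\<dots> = 0"
        using integral_box_zero[OF SL f 0] sub ab by blast
      finally show False
        using d(2)[OF h(1,2)] x box_subset_cbox[of a b] by (auto simp: g_def)
    qed
    with N(1) show ?thesis by blast
  qed
  define \<B> where "\<B> = {box a b |a b :: point. cbox a b \<subseteq> S}"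
  obtain \<C> where \<C>: "\<C> \<subseteq> \<B>" "countable \<C>" "\<Union>\<C> = \<Union>\<B>"
    using Lindelof[of \<B>] by (auto simp: \<B>_def)
  have cover: "S \<subseteq> \<Union>\<C>"
  proof
    fix x assume "x \<in> S"
    then obtain e where e: "e > 0" "ball x e \<subseteq> S"
      using S openE by blast
    then obtain a b where ab: "x \<in> box a b" "box a b \<subseteq> ball x (e / 2)"
      using rational_boxes[of "e / 2" x] by auto
    have "cbox a b = closure (box a b)"
      using ab(1) closure_box[of a b] by blast
    also have "\<dots> \<subseteq> cball x (e / 2)"
      using ab(2) ball_subset_cball by (intro closure_minimal) auto
    also have "\<dots> \<subseteq> ball x e"
      using e(1) by auto
    finally show "x \<in> \<Union>\<C>"
      using \<C>(3) ab(1) e(2) unfolding \<B>_def by blast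
  qed
  have "\<forall>B\<in>\<C>. \<exists>N. negligible N \<and> (\<forall>x\<in>B - N. f x = 0)"
    using \<C>(1) local by (auto simp: \<B>_def)
  then obtain N where N: "\<And>B. B \<in> \<C> \<Longrightarrow> negligible (N B) \<and> (\<forall>x\<in>B - N B. f x = 0)"
    by metis
  have "negligible (\<Union>B\<in>\<C>. N B)"
    using N \<C>(2) unfolding negligible_iff_null_sets by (intro null_sets_UN') auto
  moreover have "\<forall>x\<in>S - (\<Union>B\<in>\<C>. N B). f x = 0"
    using cover N by blast
  ultimately show ?thesis
    unfolding ae_eq_iff_negligible[OF SL] by blast
qed

section \<open>Regular distributions\<close>

lemma reg_cong_on:
  "(\<And>x. x \<in> S \<Longrightarrow> u x * \<phi> x = v x * \<psi> x) \<Longrightarrow> reg S u \<phi> = reg S v \<psi>"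
  unfolding reg_def by (rule Bochner_Integration.integral_cong) auto

text \<open>
  The distributions agree also on arguments such as \<open>\<phi> / \<rho>\<close>, which need not be test functions: as Lebesgue
  measure is complete, both integrands are measurable or neither is, and in the latter case both
  integrals have the default value 0.
\<close>

lemma reg_cong:
  assumes S: "S \<in> sets lebesgue" and uv: "ae_eq S u v"
  shows "reg S u = reg S v"
proof
  fix \<phi>
  let ?u = "\<lambda>x. indicator S x *\<^sub>R (u x * \<phi> x)" and ?v = "\<lambda>x. indicator S x *\<^sub>R (v x * \<phi> x)"
  have ae: "AE x in lebesgue. ?u x = ?v x"
    using uv S by (auto simp: ae_eq_def AE_restrict_space_iff elim: eventually_mono)
  have sym: "AE x in lebesgue. ?v x = ?u x"
    using ae by (auto elim: eventually_mono)
  have "integral\<^sup>L lebesgue ?u = integral\<^sup>L lebesgue ?v"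
  proof (cases "?u \<in> borel_measurable lebesgue")
    case True
    then show ?thesis
      using borel_measurable_AE[OF True ae] ae by (intro integral_cong_AE) auto
  next
    case False
    moreover have "?v \<notin> borel_measurable lebesgue"
      using False borel_measurable_AE[OF _ sym] by blast
    ultimately have ni: "\<not> integrable lebesgue ?u" "\<not> integrable lebesgue ?v"
      by (auto dest: borel_measurable_integrable)
    show ?thesis
      unfolding not_integrable_integral_eq[OF ni(1)] not_integrable_integral_eq[OF ni(2)] ..
  qed
  then show "reg S u \<phi> = reg S v \<phi>"
    using S by (simp add: reg_def integral_restrict_space)
qed

lemma reg_add:
  assumes "S \<in> sets lebesgue" "\<phi> \<in> test_functions S" "locally_integrable S u" "locally_integrable S v"
  shows "reg S (\<lambda>x. u x + v x) \<phi> = reg S u \<phi> + reg S v \<phi>"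
  using integrable_times_test[OF assms(1,3,2)] integrable_times_test[OF assms(1,4,2)]
  by (simp add: reg_def distrib_right)

lemma reg_cmult: "reg S (\<lambda>x. c * u x) \<phi> = c * reg S u \<phi>"
  by (simp add: reg_def mult.assoc)

lemma reg_minus: "reg S (\<lambda>x. - u x) \<phi> = - reg S u \<phi>"
  by (simp add: reg_def)

lemma reg_diff:
  assumes "S \<in> sets lebesgue" "\<phi> \<in> test_functions S" "locally_integrable S u" "locally_integrable S v"
  shows "reg S (\<lambda>x. u x - v x) \<phi> = reg S u \<phi> - reg S v \<phi>"
  using integrable_times_test[OF assms(1,3,2)] integrable_times_test[OF assms(1,4,2)]
  by (simp add: reg_def left_diff_distrib)

lemma represents_cong:
  "S \<in> sets lebesgue \<Longrightarrow> represents S f T \<Longrightarrow> ae_eq S f g \<Longrightarrow> represents S g T"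
  using locally_integrable_cong[of S f g] reg_cong[of S f g] by (simp add: represents_def)

lemma represents_unique:
  assumes S: "open S" and f: "represents S f T" and g: "represents S g T"
  shows "ae_eq S f g"
proof -
  have "ae_eq S (\<lambda>x. f x - g x) (\<lambda>_. 0)"
  proof (rule fundamental_lemma_calculus_of_variations[OF S])
    show "locally_integrable S (\<lambda>x. f x - g x)"
      using f g by (simp add: represents_def locally_integrable_diff)
    show "reg S (\<lambda>x. f x - g x) \<phi> = 0" if "\<phi> \<in> test_functions S" for \<phi>
      using f g that S by (subst reg_diff) (auto simp: represents_def borel_open)
  qed
  then show ?thesis by (rule ae_eq_map) simp
qed

lemma test_product_rule:
  assumes "\<phi> \<in> test_functions S"
  shows "partial_deriv (1, 0) (\<lambda>x. fst x * \<phi> x) x = fst x * partial_deriv (1, 0) \<phi> x + \<phi> x"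
    and "partial_deriv (0, 1) (\<lambda>x. fst x * \<phi> x) x = fst x * partial_deriv (0, 1) \<phi> x"
proof -
  have "((\<lambda>x. fst x * \<phi> x) has_derivative
      (\<lambda>h. fst x * frechet_derivative \<phi> (at x) h + fst h * \<phi> x)) (at x)"
    by (intro has_derivative_mult has_derivative_partial test_differentiable[OF assms])
       (simp add: has_derivative_fst)
  from partial_deriv_eq[OF this]
  show "partial_deriv (1, 0) (\<lambda>x. fst x * \<phi> x) x = fst x * partial_deriv (1, 0) \<phi> x + \<phi> x"
    and "partial_deriv (0, 1) (\<lambda>x. fst x * \<phi> x) x = fst x * partial_deriv (0, 1) \<phi> x"
    by (simp_all add: partial_deriv_def)
qed

lemma test_quotient_rule:
  assumes "\<phi> \<in> test_functions S" "fst x \<noteq> 0"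
  shows "fst x * partial_deriv (1, 0) (\<lambda>x. 1 / fst x * \<phi> x) x = partial_deriv (1, 0) \<phi> x - \<phi> x / fst x"
proof -
  have "((\<lambda>x. 1 / fst x * \<phi> x) has_derivative
      (\<lambda>h. 1 / fst x * frechet_derivative \<phi> (at x) h + - (fst h / (fst x)\<^sup>2) * \<phi> x)) (at x)"
    using assms(2)
    by (intro has_derivative_mult has_derivative_partial test_differentiable[OF assms(1)])
       (auto intro!: derivative_eq_intros simp: power2_eq_square field_simps)
  from partial_deriv_eq[OF this, of "(1, 0)"] assms(2)
  show ?thesis
    by (simp add: partial_deriv_def power2_eq_square field_simps)
qed

lemma Basis_point: "(1, 0) \<in> (Basis :: point set)" "(0, 1) \<in> (Basis :: point set)"
  by (auto simp: Basis_prod_def)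

text \<open>
  The product rule with the weight moved to the test function: \<open>\<rho> \<phi>\<close> is a test function again, so an
  identity known for the weak derivatives of \<open>u\<close> may be applied to it.
\<close>

lemma D\<rho>_times_fst:
  assumes S: "S \<in> sets lebesgue" and \<phi>: "\<phi> \<in> test_functions S" and u: "locally_integrable S u"
  shows "D\<rho> (reg S (\<lambda>x. fst x * u x)) \<phi> = D\<rho> (reg S u) (\<lambda>x. fst x * \<phi> x) + reg S u \<phi>"
proof -
  let ?d = "partial_deriv (1, 0)"
  have "reg S u (?d (\<lambda>x. fst x * \<phi> x)) = (\<integral>x. u x * (fst x * ?d \<phi> x) + u x * \<phi> x \<partial>lebesgue_on S)"
    by (simp add: reg_def test_product_rule[OF \<phi>] distrib_left)
  also have "\<dots> = (\<integral>x. u x * (fst x * ?d \<phi> x) \<partial>lebesgue_on S) + reg S u \<phi>"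
    unfolding reg_def
    by (intro Bochner_Integration.integral_add integrable_times_test S u \<phi> test_mult_fst
        test_partial_deriv Basis_point)
  also have "(\<integral>x. u x * (fst x * ?d \<phi> x) \<partial>lebesgue_on S) = reg S (\<lambda>x. fst x * u x) (?d \<phi>)"
    by (simp add: reg_def mult_ac)
  finally show ?thesis
    by (simp add: D\<rho>_def)
qed

lemma Dz_times_fst:
  assumes "\<phi> \<in> test_functions S"
  shows "Dz (reg S (\<lambda>x. fst x * u x)) \<phi> = Dz (reg S u) (\<lambda>x. fst x * \<phi> x)"
  by (simp add: Dz_def reg_def test_product_rule[OF assms] mult_ac)

text \<open>
  The identity \<open>1/\<rho> \<partial>\<^sub>\<rho> (\<rho> u) = \<partial>\<^sub>\<rho> u + u / \<rho>\<close>. The factor \<open>\<rho>\<close> cancels the singularity of the derivative of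
  \<open>\<phi> / \<rho>\<close>, and what remains contains only \<open>\<phi>\<close> and its derivative.
\<close>

lemma D\<rho>_weighted:
  assumes S: "S \<in> sets lebesgue" and pos: "\<forall>x\<in>S. fst x > 0"
    and \<phi>: "\<phi> \<in> test_functions S" and u: "locally_integrable S u"
  shows "mult (\<lambda>x. 1 / fst x) (D\<rho> (mult fst (reg S u))) \<phi> = D\<rho> (reg S u) \<phi> + reg S (\<lambda>x. 1 / fst x * u x) \<phi>"
proof -
  let ?d = "partial_deriv (1, 0)"
  have u': "locally_integrable S (\<lambda>x. 1 / fst x * u x)"
    by (intro locally_integrable_times u continuous_intros) (use pos in force)
  have "mult fst (reg S u) (?d (\<lambda>x. 1 / fst x * \<phi> x))
      = (\<integral>x. u x * ?d \<phi> x - 1 / fst x * u x * \<phi> x \<partial>lebesgue_on S)"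
    unfolding mult_def reg_def
  proof (rule Bochner_Integration.integral_cong)
    fix x assume "x \<in> space (lebesgue_on S)"
    then have "fst x \<noteq> 0" using pos by force
    then show "u x * (fst x * ?d (\<lambda>x. 1 / fst x * \<phi> x) x) = u x * ?d \<phi> x - 1 / fst x * u x * \<phi> x"
      by (simp only: test_quotient_rule[OF \<phi>] not_False_eq_True) (simp add: right_diff_distrib)
  qed simp
  also have "\<dots> = reg S u (?d \<phi>) - reg S (\<lambda>x. 1 / fst x * u x) \<phi>"
    unfolding reg_def
    by (intro Bochner_Integration.integral_diff integrable_times_test S u u' \<phi>
        test_partial_deriv Basis_point)
  finally show ?thesis
    by (simp add: D\<rho>_def mult_def[of "\<lambda>x. 1 / fst x"])
qed

lemma D_diff:
  assumes "S \<in> sets lebesgue" "\<phi> \<in> test_functions S" "locally_integrable S u" "locally_integrable S v"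
  shows "D\<rho> (reg S (\<lambda>x. u x - v x)) \<phi> = D\<rho> (reg S u) \<phi> - D\<rho> (reg S v) \<phi>"
    and "Dz (reg S (\<lambda>x. u x - v x)) \<phi> = Dz (reg S u) \<phi> - Dz (reg S v) \<phi>"
  using assms by (simp_all add: D\<rho>_def Dz_def reg_diff test_partial_deriv Basis_point)

lemma D_cmult:
  "D\<rho> (reg S (\<lambda>x. c * u x)) \<phi> = c * D\<rho> (reg S u) \<phi>"
  "Dz (reg S (\<lambda>x. c * u x)) \<phi> = c * Dz (reg S u) \<phi>"
  by (simp_all add: D\<rho>_def Dz_def reg_cmult)

lemma D_minus:
  "D\<rho> (reg S (\<lambda>x. - u x)) \<phi> = - D\<rho> (reg S u) \<phi>"
  "Dz (reg S (\<lambda>x. - u x)) \<phi> = - Dz (reg S u) \<phi>"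
  by (simp_all add: D\<rho>_def Dz_def reg_minus)

lemma representsD: "represents S f T \<Longrightarrow> \<phi> \<in> test_functions S \<Longrightarrow> T \<phi> = reg S f \<phi>"
  and represents_locally_integrable: "represents S f T \<Longrightarrow> locally_integrable S f"
  by (auto simp: represents_def)

lemma reg_move_fst: "reg S u (\<lambda>x. fst x * \<phi> x) = reg S (\<lambda>x. fst x * u x) \<phi>"
  by (simp add: reg_def mult_ac)

lemma mult_reg: "mult a (reg S u) \<phi> = reg S (\<lambda>x. a x * u x) \<phi>"
  by (simp add: mult_def reg_def mult_ac)

section \<open>The cylindrical operators in Cartesian unknowns\<close>

definition join :: "planar_field \<Rightarrow> scalar_field \<Rightarrow> cyl_field" where
  "join w t = (\<lambda>x. (fst (w x), snd (w x), t x))"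

lemma Prot_components: "Prot p = (snd p, - fst p)"
  by (simp add: Prot_def split_beta)

text \<open>
  With \<open>u\<close> replaced by \<open>\<rho> u / m\<close>, the derivative in \<open>\<rho>\<close> contributes the extra term \<open>u / m\<close>; it is exactly the
  term by which \<open>\<eta>1_inv m\<close> couples the radial component to the angular one.
\<close>

lemma weak_gradm_\<eta>0_inv:
  assumes S: "S \<in> sets lebesgue" and pos: "\<forall>x\<in>S. fst x > 0" and m: "m \<noteq> 0"
    and g: "weak_grad S u g"
  shows "weak_gradm m S (\<eta>0_inv m u) (\<eta>1_inv m (join g (\<lambda>x. - u x)))"
proof -
  have u: "locally_integrable S u" and g1: "represents S (\<lambda>x. fst (g x)) (D\<rho> (reg S u))"
    and g2: "represents S (\<lambda>x. snd (g x)) (Dz (reg S u))"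
    using g by (auto simp: weak_grad_def)
  have \<eta>0: "\<eta>0_inv m u = (\<lambda>x. 1 / of_int m * (fst x * u x))"
    by (simp add: \<eta>0_inv_def)
  have \<eta>1: "\<eta>1_inv m (join g (\<lambda>x. - u x)) =
      (\<lambda>x. (1 / of_int m * (fst x * fst (g x) + u x), 1 / of_int m * (fst x * snd (g x)), - u x))"
    by (simp add: \<eta>1_inv_def join_def)
  note L = u represents_locally_integrable[OF g1] represents_locally_integrable[OF g2]
  have fu: "locally_integrable S (\<lambda>x. fst x * f x)" if "locally_integrable S f" for f :: scalar_field
    by (intro locally_integrable_times that continuous_intros)
  note rules = locally_integrable_const_times locally_integrable_add fu L
  show ?thesis
    unfolding weak_gradm_def \<eta>0 \<eta>1 fst_conv snd_conv
  proof (intro conjI)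
    show "locally_integrable S (\<lambda>x. 1 / of_int m * (fst x * u x))"
      by (intro rules)
    show "represents S (\<lambda>x. 1 / of_int m * (fst x * fst (g x) + u x))
        (D\<rho> (reg S (\<lambda>x. 1 / of_int m * (fst x * u x))))"
      unfolding represents_def
      using representsD[OF g1] fu L S
      by (auto intro!: rules simp: D_cmult D\<rho>_times_fst reg_cmult reg_add test_mult_fst reg_move_fst
        simp del: times_divide_eq_left)
    show "represents S (\<lambda>x. 1 / of_int m * (fst x * snd (g x)))
        (Dz (reg S (\<lambda>x. 1 / of_int m * (fst x * u x))))"
      unfolding represents_def
      using representsD[OF g2] fu L S
      by (auto intro!: rules simp: D_cmult Dz_times_fst reg_cmult test_mult_fst reg_move_fst
        simp del: times_divide_eq_left)
    have "reg S (\<lambda>x. - u x) \<phi> = mult (\<lambda>x. - of_int m / fst x) (reg S (\<lambda>x. 1 / of_int m * (fst x * u x))) \<phi>"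
      for \<phi>
      unfolding mult_reg by (rule reg_cong_on) (use pos m in force)
    moreover have "locally_integrable S (\<lambda>x. - u x)"
      using locally_integrable_const_times[OF u, of "- 1"] by simp
    ultimately show "represents S (\<lambda>x. - u x)
        (mult (\<lambda>x. - of_int m / fst x) (reg S (\<lambda>x. 1 / of_int m * (fst x * u x))))"
      by (simp add: represents_def)
  qed
qed

text \<open>
  The weak derivatives of \<open>w\<close> need not exist one by one, only their combination \<open>curl w\<close> does. The angular
  component of the curl is therefore computed as a whole, by testing \<open>curl w\<close> with \<open>\<rho> \<phi>\<close>.
\<close>

lemma weak_curlm_\<eta>1_inv:
  assumes S: "S \<in> sets lebesgue" and pos: "\<forall>x\<in>S. fst x > 0" and m: "m \<noteq> 0"
    and c: "weak_curl S w c" and g: "weak_grad S t g"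
  shows "weak_curlm m S (\<eta>1_inv m (join w t))
    (\<eta>2_inv m (join (\<lambda>x. - Prot (g x + w x)) (\<lambda>x. - c x)))"
proof -
  have t: "locally_integrable S t" and g1: "represents S (\<lambda>x. fst (g x)) (D\<rho> (reg S t))"
    and g2: "represents S (\<lambda>x. snd (g x)) (Dz (reg S t))"
    using g by (auto simp: weak_grad_def)
  have w: "locally_integrable S w" and
    c: "represents S c (\<lambda>\<phi>. D\<rho> (reg S (\<lambda>x. snd (w x))) \<phi> - Dz (reg S (\<lambda>x. fst (w x))) \<phi>)"
    using c by (auto simp: weak_curl_def)
  have \<eta>1: "\<eta>1_inv m (join w t) =
      (\<lambda>x. (1 / of_int m * (fst x * fst (w x) - t x), 1 / of_int m * (fst x * snd (w x)), t x))"
    by (simp add: \<eta>1_inv_def join_def)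
  have \<eta>2: "\<eta>2_inv m (join (\<lambda>x. - Prot (g x + w x)) (\<lambda>x. - c x)) =
      (\<lambda>x. (- (snd (g x) + snd (w x)), fst (g x) + fst (w x),
        - 1 / of_int m * (fst x * c x + (snd (g x) + snd (w x)))))"
    by (auto simp: \<eta>2_inv_def join_def Prot_components fun_eq_iff diff_divide_distrib add_divide_distrib)
  note L = t w locally_integrable_fst[OF w] locally_integrable_snd[OF w]
    represents_locally_integrable[OF g1] represents_locally_integrable[OF g2]
    represents_locally_integrable[OF c]
  have fu: "locally_integrable S (\<lambda>x. fst x * f x)" if "locally_integrable S f" for f :: scalar_field
    by (intro locally_integrable_times that continuous_intros)
  have neg: "locally_integrable S (\<lambda>x. - f x)" if "locally_integrable S f" for f :: scalar_field
    using locally_integrable_const_times[OF that, of "- 1"] by simp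
  note rules = locally_integrable_const_times locally_integrable_add locally_integrable_diff neg fu L
  show ?thesis
    unfolding weak_curlm_def \<eta>1 \<eta>2 fst_conv snd_conv Let_def
  proof (intro conjI)
    show "locally_integrable S (\<lambda>x. (1 / of_int m * (fst x * fst (w x) - t x),
        1 / of_int m * (fst x * snd (w x)), t x))"
      by (intro locally_integrable_Pair rules)
    show "represents S (\<lambda>x. - (snd (g x) + snd (w x)))
        (\<lambda>\<phi>. mult (\<lambda>x. - of_int m / fst x) (reg S (\<lambda>x. 1 / of_int m * (fst x * snd (w x)))) \<phi>
          - Dz (reg S t) \<phi>)"
      unfolding represents_def
    proof (intro conjI ballI)
      fix \<phi> assume \<phi>: "\<phi> \<in> test_functions S"
      have "mult (\<lambda>x. - of_int m / fst x) (reg S (\<lambda>x. 1 / of_int m * (fst x * snd (w x)))) \<phi>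
          = reg S (\<lambda>x. - snd (w x)) \<phi>"
        unfolding mult_reg by (rule reg_cong_on) (use pos m in force)
      then show "reg S (\<lambda>x. - (snd (g x) + snd (w x))) \<phi> =
          mult (\<lambda>x. - of_int m / fst x) (reg S (\<lambda>x. 1 / of_int m * (fst x * snd (w x)))) \<phi>
          - Dz (reg S t) \<phi>"
        using representsD[OF g2 \<phi>] unfolding reg_minus reg_add[OF S \<phi> L(6,4)] by linarith
    qed (intro rules)
    show "represents S (\<lambda>x. fst (g x) + fst (w x)) (mult (\<lambda>x. 1 / fst x)
        (\<lambda>\<phi>. D\<rho> (mult fst (reg S t)) \<phi> + of_int m * reg S (\<lambda>x. 1 / of_int m * (fst x * fst (w x) - t x)) \<phi>))"
      unfolding represents_def
    proof (intro conjI ballI)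
      fix \<phi> assume \<phi>: "\<phi> \<in> test_functions S"
      have t': "locally_integrable S (\<lambda>x. 1 / fst x * t x)"
        by (intro locally_integrable_times t continuous_intros) (use pos in force)
      have "of_int m * reg S (\<lambda>x. 1 / of_int m * (fst x * fst (w x) - t x)) (\<lambda>x. 1 / fst x * \<phi> x)
          = reg S (\<lambda>x. fst x * fst (w x) - t x) (\<lambda>x. 1 / fst x * \<phi> x)"
        using m by (simp only: reg_cmult) simp
      also have "\<dots> = reg S (\<lambda>x. fst (w x) - 1 / fst x * t x) \<phi>"
        by (rule reg_cong_on) (use pos in \<open>force simp: field_simps\<close>)
      also have "\<dots> = reg S (\<lambda>x. fst (w x)) \<phi> - reg S (\<lambda>x. 1 / fst x * t x) \<phi>"
        by (rule reg_diff[OF S \<phi> L(3) t'])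
      finally show "reg S (\<lambda>x. fst (g x) + fst (w x)) \<phi> = mult (\<lambda>x. 1 / fst x)
          (\<lambda>\<phi>. D\<rho> (mult fst (reg S t)) \<phi>
            + of_int m * reg S (\<lambda>x. 1 / of_int m * (fst x * fst (w x) - t x)) \<phi>) \<phi>"
        using D\<rho>_weighted[OF S pos \<phi> t] representsD[OF g1 \<phi>]
        unfolding mult_def[of "\<lambda>x. 1 / fst x"] reg_add[OF S \<phi> L(5,3)] by linarith
    qed (intro rules)
    show "represents S (\<lambda>x. - 1 / of_int m * (fst x * c x + (snd (g x) + snd (w x))))
        (\<lambda>\<phi>. Dz (reg S (\<lambda>x. 1 / of_int m * (fst x * fst (w x) - t x))) \<phi>
          - D\<rho> (reg S (\<lambda>x. 1 / of_int m * (fst x * snd (w x)))) \<phi>)"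
      unfolding represents_def
    proof (intro conjI ballI)
      fix \<phi> assume \<phi>: "\<phi> \<in> test_functions S"
      have "D\<rho> (reg S (\<lambda>x. snd (w x))) (\<lambda>x. fst x * \<phi> x) - Dz (reg S (\<lambda>x. fst (w x))) (\<lambda>x. fst x * \<phi> x)
          = reg S (\<lambda>x. fst x * c x) \<phi>"
        using representsD[OF c test_mult_fst[OF \<phi>]] by (simp add: reg_move_fst)
      moreover have "Dz (reg S t) \<phi> = reg S (\<lambda>x. snd (g x)) \<phi>"
        by (rule representsD[OF g2 \<phi>])
      moreover have "reg S (\<lambda>x. fst x * c x + (snd (g x) + snd (w x))) \<phi>
          = reg S (\<lambda>x. fst x * c x) \<phi> + (reg S (\<lambda>x. snd (g x)) \<phi> + reg S (\<lambda>x. snd (w x)) \<phi>)"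
        unfolding reg_add[OF S \<phi> L(6,4), symmetric]
        by (rule reg_add[OF S \<phi> fu[OF L(7)] locally_integrable_add[OF L(6,4)]])
      moreover have "D\<rho> (reg S (\<lambda>x. fst x * snd (w x))) \<phi>
          = D\<rho> (reg S (\<lambda>x. snd (w x))) (\<lambda>x. fst x * \<phi> x) + reg S (\<lambda>x. snd (w x)) \<phi>"
        by (rule D\<rho>_times_fst[OF S \<phi> L(4)])
      moreover have "Dz (reg S (\<lambda>x. fst x * fst (w x) - t x)) \<phi>
          = Dz (reg S (\<lambda>x. fst (w x))) (\<lambda>x. fst x * \<phi> x) - Dz (reg S t) \<phi>"
        unfolding Dz_times_fst[OF \<phi>, symmetric] by (rule D_diff(2)[OF S \<phi> fu[OF L(3)] t])
      ultimately have "reg S (\<lambda>x. fst x * c x + (snd (g x) + snd (w x))) \<phi>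
          = D\<rho> (reg S (\<lambda>x. fst x * snd (w x))) \<phi> - Dz (reg S (\<lambda>x. fst x * fst (w x) - t x)) \<phi>"
        by linarith
      then show "reg S (\<lambda>x. - 1 / of_int m * (fst x * c x + (snd (g x) + snd (w x)))) \<phi> =
          Dz (reg S (\<lambda>x. 1 / of_int m * (fst x * fst (w x) - t x))) \<phi>
          - D\<rho> (reg S (\<lambda>x. 1 / of_int m * (fst x * snd (w x)))) \<phi>"
        unfolding reg_cmult D_cmult by (simp add: diff_divide_distrib)
    qed (intro rules)
  qed
qed

text \<open>
  The term \<open>v\<^sub>\<rho> / \<rho>\<close> of the cylindrical divergence cancels against the one hidden in the angular
  component of \<open>\<eta>2_inv m\<close>.
\<close>

lemma weak_divm_\<eta>2_inv:
  assumes S: "S \<in> sets lebesgue" and pos: "\<forall>x\<in>S. fst x > 0" and m: "m \<noteq> 0"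
    and e: "weak_div S v e" and d: "locally_integrable S d"
  shows "weak_divm m S (\<eta>2_inv m (join v d)) (\<lambda>x. e x - d x)"
proof -
  have v: "locally_integrable S v" and
    e: "represents S e (\<lambda>\<phi>. D\<rho> (reg S (\<lambda>x. fst (v x))) \<phi> + Dz (reg S (\<lambda>x. snd (v x))) \<phi>)"
    using e by (auto simp: weak_div_def)
  have \<eta>2: "\<eta>2_inv m (join v d) =
      (\<lambda>x. (fst (v x), snd (v x), 1 / of_int m * (fst x * d x + fst (v x))))"
    by (simp add: \<eta>2_inv_def join_def)
  note L = locally_integrable_fst[OF v] locally_integrable_snd[OF v] d represents_locally_integrable[OF e]
  have fu: "locally_integrable S (\<lambda>x. fst x * f x)" if "locally_integrable S f" for f :: scalar_field
    by (intro locally_integrable_times that continuous_intros)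
  note rules = locally_integrable_const_times locally_integrable_add locally_integrable_diff fu L
  show ?thesis
    unfolding weak_divm_def \<eta>2 fst_conv snd_conv Let_def
  proof (intro conjI)
    show "locally_integrable S (\<lambda>x. (fst (v x), snd (v x), 1 / of_int m * (fst x * d x + fst (v x))))"
      by (intro locally_integrable_Pair rules)
    show "represents S (\<lambda>x. e x - d x) (\<lambda>\<phi>. mult (\<lambda>x. 1 / fst x) (D\<rho> (mult fst (reg S (\<lambda>x. fst (v x))))) \<phi>
        - mult (\<lambda>x. of_int m / fst x) (reg S (\<lambda>x. 1 / of_int m * (fst x * d x + fst (v x)))) \<phi>
        + Dz (reg S (\<lambda>x. snd (v x))) \<phi>)"
      unfolding represents_def
    proof (intro conjI ballI)
      fix \<phi> assume \<phi>: "\<phi> \<in> test_functions S"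
      have v': "locally_integrable S (\<lambda>x. 1 / fst x * fst (v x))"
        by (intro locally_integrable_times L continuous_intros) (use pos in force)
      have "mult (\<lambda>x. of_int m / fst x) (reg S (\<lambda>x. 1 / of_int m * (fst x * d x + fst (v x)))) \<phi>
          = reg S (\<lambda>x. d x + 1 / fst x * fst (v x)) \<phi>"
        unfolding mult_reg by (rule reg_cong_on) (use pos m in \<open>force simp: field_simps\<close>)
      also have "\<dots> = reg S d \<phi> + reg S (\<lambda>x. 1 / fst x * fst (v x)) \<phi>"
        by (rule reg_add[OF S \<phi> d v'])
      finally show "reg S (\<lambda>x. e x - d x) \<phi> =
          mult (\<lambda>x. 1 / fst x) (D\<rho> (mult fst (reg S (\<lambda>x. fst (v x))))) \<phi>
          - mult (\<lambda>x. of_int m / fst x) (reg S (\<lambda>x. 1 / of_int m * (fst x * d x + fst (v x)))) \<phi>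
          + Dz (reg S (\<lambda>x. snd (v x))) \<phi>"
        using D\<rho>_weighted[OF S pos \<phi> L(1)] representsD[OF e \<phi>] reg_diff[OF S \<phi> L(4,3)] by linarith
    qed (intro rules)
  qed
qed

lemma ae_eq_prod:
  "ae_eq S (\<lambda>x. fst (u x)) (\<lambda>x. fst (v x)) \<Longrightarrow> ae_eq S (\<lambda>x. snd (u x)) (\<lambda>x. snd (v x)) \<Longrightarrow> ae_eq S u v"
  by (erule ae_eq_map2, assumption) (rule prod_eqI)

lemma ae_eq_comp: "ae_eq S u v \<Longrightarrow> ae_eq S (\<lambda>x. h (u x)) (\<lambda>x. h (v x))"
  by (erule ae_eq_map) simp

lemma weak_gradm_cong:
  assumes S: "S \<in> sets lebesgue" and u: "ae_eq S u u'" and v: "ae_eq S v v'" and g: "weak_gradm m S u v"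
  shows "weak_gradm m S u' v'"
  using g locally_integrable_cong[OF S _ u]
    represents_cong[OF S _ ae_eq_comp[OF v, of fst]]
    represents_cong[OF S _ ae_eq_comp[OF v, of "\<lambda>p. fst (snd p)"]]
    represents_cong[OF S _ ae_eq_comp[OF v, of "\<lambda>p. snd (snd p)"]]
  by (simp add: weak_gradm_def reg_cong[OF S u])

lemma weak_curlm_cong:
  assumes S: "S \<in> sets lebesgue" and u: "ae_eq S u u'" and v: "ae_eq S v v'" and g: "weak_curlm m S u v"
  shows "weak_curlm m S u' v'"
  using g locally_integrable_cong[OF S _ u]
    represents_cong[OF S _ ae_eq_comp[OF v, of fst]]
    represents_cong[OF S _ ae_eq_comp[OF v, of "\<lambda>p. fst (snd p)"]]
    represents_cong[OF S _ ae_eq_comp[OF v, of "\<lambda>p. snd (snd p)"]]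
  by (simp add: weak_curlm_def Let_def reg_cong[OF S ae_eq_comp[OF u, of fst]]
      reg_cong[OF S ae_eq_comp[OF u, of "\<lambda>p. fst (snd p)"]]
      reg_cong[OF S ae_eq_comp[OF u, of "\<lambda>p. snd (snd p)"]])

lemma weak_divm_cong:
  assumes S: "S \<in> sets lebesgue" and u: "ae_eq S u u'" and v: "ae_eq S v v'" and g: "weak_divm m S u v"
  shows "weak_divm m S u' v'"
  using g locally_integrable_cong[OF S _ u] represents_cong[OF S _ v]
  by (simp add: weak_divm_def reg_cong[OF S ae_eq_comp[OF u, of fst]]
      reg_cong[OF S ae_eq_comp[OF u, of "\<lambda>p. fst (snd p)"]]
      reg_cong[OF S ae_eq_comp[OF u, of "\<lambda>p. snd (snd p)"]])

lemma weak_gradm_unique: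
  assumes S: "open S" and "weak_gradm m S u v" "weak_gradm m S u v'"
  shows "ae_eq S v v'"
  using assms(2,3) represents_unique[OF S] unfolding weak_gradm_def
  by (intro ae_eq_prod) blast+

lemma weak_curlm_unique:
  assumes S: "open S" and "weak_curlm m S u v" "weak_curlm m S u v'"
  shows "ae_eq S v v'"
  using assms(2,3) represents_unique[OF S] unfolding weak_curlm_def Let_def
  by (intro ae_eq_prod) blast+

lemma weak_divm_unique:
  assumes S: "open S" and "weak_divm m S u v" "weak_divm m S u v'"
  shows "ae_eq S v v'"
  using assms(2,3) represents_unique[OF S] unfolding weak_divm_def Let_def by blast

text \<open>
  Existence and uniqueness together with invariance under changes on null sets turn the formulas above
  into equivalences. They reduce every statement about the cylindrical operators to one about planar ones.
\<close>

lemma weak_gradm_iff: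
  assumes S: "open S" and pos: "\<forall>x\<in>S. fst x > 0" and m: "m \<noteq> 0"
    and g: "weak_grad S t g" and u: "ae_eq S u (\<eta>0_inv m t)"
  shows "weak_gradm m S u v \<longleftrightarrow> ae_eq S v (\<eta>1_inv m (join g (\<lambda>x. - t x)))"
proof -
  have SL: "S \<in> sets lebesgue" using S by (simp add: borel_open)
  note * = weak_gradm_\<eta>0_inv[OF SL pos m g]
  show ?thesis
    using weak_gradm_cong[OF SL ae_eq_sym[OF u] ae_eq_sym *] weak_gradm_unique[OF S]
      weak_gradm_cong[OF SL ae_eq_sym[OF u] ae_eq_refl *] by blast
qed

lemma weak_curlm_iff:
  assumes S: "open S" and pos: "\<forall>x\<in>S. fst x > 0" and m: "m \<noteq> 0"
    and c: "weak_curl S w c" and g: "weak_grad S t g" and u: "ae_eq S u (\<eta>1_inv m (join w t))"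
  shows "weak_curlm m S u v \<longleftrightarrow> ae_eq S v (\<eta>2_inv m (join (\<lambda>x. - Prot (g x + w x)) (\<lambda>x. - c x)))"
proof -
  have SL: "S \<in> sets lebesgue" using S by (simp add: borel_open)
  note * = weak_curlm_\<eta>1_inv[OF SL pos m c g]
  show ?thesis
    using weak_curlm_cong[OF SL ae_eq_sym[OF u] ae_eq_sym *] weak_curlm_unique[OF S]
      weak_curlm_cong[OF SL ae_eq_sym[OF u] ae_eq_refl *] by blast
qed

lemma weak_divm_iff:
  assumes S: "open S" and pos: "\<forall>x\<in>S. fst x > 0" and m: "m \<noteq> 0"
    and e: "weak_div S w e" and d: "locally_integrable S d" and u: "ae_eq S u (\<eta>2_inv m (join w d))"
  shows "weak_divm m S u v \<longleftrightarrow> ae_eq S v (\<lambda>x. e x - d x)"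
proof -
  have SL: "S \<in> sets lebesgue" using S by (simp add: borel_open)
  note * = weak_divm_\<eta>2_inv[OF SL pos m e d]
  show ?thesis
    using weak_divm_cong[OF SL ae_eq_sym[OF u] ae_eq_sym *] weak_divm_unique[OF S]
      weak_divm_cong[OF SL ae_eq_sym[OF u] ae_eq_refl *] by blast
qed

section \<open>Identities for the planar operators\<close>

lemma locally_integrable_minus: "locally_integrable S u \<Longrightarrow> locally_integrable S (\<lambda>x. - u x)"
  by (rule locally_integrable_linear[OF _ bounded_linear_minus[OF bounded_linear_ident]])

lemma represents_minus:
  assumes "represents S f T" "\<And>\<phi>. \<phi> \<in> test_functions S \<Longrightarrow> T' \<phi> = - T \<phi>"
  shows "represents S (\<lambda>x. - f x) T'"
  using assms by (simp add: represents_def reg_minus locally_integrable_minus)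

lemma weak_grad_minus:
  assumes "weak_grad S t g"
  shows "weak_grad S (\<lambda>x. - t x) (\<lambda>x. - g x)"
  using assms unfolding weak_grad_def fst_uminus snd_uminus
  by (auto intro!: locally_integrable_minus elim!: represents_minus simp: D_minus)

lemma weak_curl_minus:
  assumes "weak_curl S w c"
  shows "weak_curl S (\<lambda>x. - w x) (\<lambda>x. - c x)"
  using assms unfolding weak_curl_def fst_uminus snd_uminus
  by (auto intro!: locally_integrable_minus elim!: represents_minus simp: D_minus)

text \<open>Both terms of the curl are \<open>t\<close> tested with a mixed second derivative of \<open>\<phi>\<close>.\<close>

lemma weak_curl_grad:
  assumes "weak_grad S t g"
  shows "weak_curl S g (\<lambda>_. 0)"
proof -
  have g1: "represents S (\<lambda>x. fst (g x)) (D\<rho> (reg S t))" and g2: "represents S (\<lambda>x. snd (g x)) (Dz (reg S t))"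
    using assms by (auto simp: weak_grad_def)
  have "D\<rho> (reg S (\<lambda>x. snd (g x))) \<phi> - Dz (reg S (\<lambda>x. fst (g x))) \<phi> = 0"
    if \<phi>: "\<phi> \<in> test_functions S" for \<phi>
  proof -
    have "Ck 2 \<phi>" using \<phi> by (simp add: test_functions_def)
    then have "partial_deriv (0, 1) (partial_deriv (1, 0) \<phi>) = partial_deriv (1, 0) (partial_deriv (0, 1) \<phi>)"
      by (intro partial_deriv_commute Basis_point)
    moreover have "D\<rho> (reg S (\<lambda>x. snd (g x))) \<phi> = reg S t (partial_deriv (0, 1) (partial_deriv (1, 0) \<phi>))"
      using representsD[OF g2 test_partial_deriv[OF \<phi> Basis_point(1)]] by (simp add: D\<rho>_def Dz_def)
    moreover have "Dz (reg S (\<lambda>x. fst (g x))) \<phi> = reg S t (partial_deriv (1, 0) (partial_deriv (0, 1) \<phi>))"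
      using representsD[OF g1 test_partial_deriv[OF \<phi> Basis_point(2)]] by (simp add: D\<rho>_def Dz_def)
    ultimately show ?thesis by simp
  qed
  moreover have "locally_integrable S g"
    using locally_integrable_Pair[OF g1[THEN represents_locally_integrable] g2[THEN represents_locally_integrable]]
    by simp
  moreover have "locally_integrable S (\<lambda>_. 0 :: real)"
    by (simp add: locally_integrable_def)
  ultimately show ?thesis
    by (simp add: weak_curl_def represents_def reg_def)
qed

lemma weak_curl_add:
  assumes S: "S \<in> sets lebesgue" and w: "weak_curl S w c" and w': "weak_curl S w' c'"
  shows "weak_curl S (\<lambda>x. w x + w' x) (\<lambda>x. c x + c' x)"
proof -
  have L: "locally_integrable S w" "locally_integrable S w'" "locally_integrable S c" "locally_integrable S c'"
    using w w' by (auto simp: weak_curl_def represents_def)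
  note L1 = L(1,2)[THEN locally_integrable_fst] and L2 = L(1,2)[THEN locally_integrable_snd]
  have "reg S (\<lambda>x. c x + c' x) \<phi> = D\<rho> (reg S (\<lambda>x. snd (w x) + snd (w' x))) \<phi> - Dz (reg S (\<lambda>x. fst (w x) + fst (w' x))) \<phi>"
    if \<phi>: "\<phi> \<in> test_functions S" for \<phi>
    using w w' \<phi> reg_add[OF S test_partial_deriv[OF \<phi> Basis_point(1)] L2]
      reg_add[OF S test_partial_deriv[OF \<phi> Basis_point(2)] L1] reg_add[OF S \<phi> L(3,4)]
    by (simp add: weak_curl_def represents_def D\<rho>_def Dz_def)
  then show ?thesis
    using L by (simp add: weak_curl_def represents_def locally_integrable_add)
qed

lemma bounded_linear_Prot: "bounded_linear Prot"
  unfolding Prot_components[abs_def]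
  by (intro bounded_linear_Pair bounded_linear_snd bounded_linear_minus bounded_linear_fst)

lemma weak_div_Prot:
  assumes "weak_curl S w c"
  shows "weak_div S (\<lambda>x. Prot (w x)) c"
  using assms locally_integrable_linear[OF _ bounded_linear_Prot]
  by (simp add: weak_div_def weak_curl_def Prot_components D_minus)

section \<open>Exactness of the discrete sequence\<close>

locale discrete_sequence =
  fixes m :: int and S :: "point set"
    and X0h X2h :: "scalar_field set" and X1h X1sh :: "planar_field set"
  assumes m: "m \<noteq> 0" and S: "open S" and pos: "\<forall>x\<in>S. fst x > 0"
    and spaces: "discrete_spaces S X0h X1h X1sh X2h"
begin

lemma S_in_lebesgue: "S \<in> sets lebesgue" using S by (simp add: borel_open)

lemma subspaces: "findim_subspace S X0h (X0 S)" "findim_subspace S X1h (X1 S)"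
  "findim_subspace S X1sh (X1s S)" "findim_subspace S X2h (X2 S)"
  using spaces unfolding discrete_spaces_def by blast+

lemma minus_mem:
  assumes "findim_subspace S V X" "u \<in> V"
  shows "(\<lambda>x. - u x) \<in> V"
proof -
  have "(\<lambda>x. (- 1) *\<^sub>R u x) \<in> V"
    using assms unfolding findim_subspace_def by blast
  then show ?thesis by simp
qed

lemma zero_mem: "findim_subspace S V X \<Longrightarrow> (\<lambda>x. 0) \<in> V"
  and add_mem: "findim_subspace S V X \<Longrightarrow> u \<in> V \<Longrightarrow> v \<in> V \<Longrightarrow> (\<lambda>x. u x + v x) \<in> V"
  and ae_mem: "findim_subspace S V X \<Longrightarrow> u \<in> V \<Longrightarrow> ae_eq S u v \<Longrightarrow> v \<in> V"
  unfolding findim_subspace_def by blast+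

lemma X0h_grad:
  assumes "t \<in> X0h"
  obtains g where "g \<in> X1h" "weak_grad S t g"
proof -
  obtain g where g: "weak_grad S t g"
    using assms subspaces(1) by (auto simp: findim_subspace_def X0_def)
  moreover from g have "g \<in> X1h"
    using assms spaces by (auto simp: discrete_spaces_def op_image_def)
  ultimately show thesis using that by blast
qed

lemma X1h_curl:
  assumes "w \<in> X1h"
  obtains c where "c \<in> X2h" "weak_curl S w c"
proof -
  obtain c where c: "weak_curl S w c"
    using assms subspaces(2) by (auto simp: findim_subspace_def X1_def)
  moreover from c have "c \<in> X2h"
    using assms spaces by (auto simp: discrete_spaces_def op_image_def)
  ultimately show thesis using that by blast
qed

lemma Prot_mem: "w \<in> X1h \<Longrightarrow> (\<lambda>x. Prot (w x)) \<in> X1sh"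
  using spaces by (auto simp: discrete_spaces_def comp_def)

lemma X1sh_Prot:
  assumes "v \<in> X1sh"
  obtains w where "w \<in> X1h" "v = (\<lambda>x. Prot (w x))"
  using assms spaces by (auto simp: discrete_spaces_def comp_def)

lemma X2h_locally_integrable: "d \<in> X2h \<Longrightarrow> locally_integrable S d"
  using L2_locally_integrable[OF S_in_lebesgue] subspaces(4) by (auto simp: findim_subspace_def X2_def)

lemma field_product_iff: "u \<in> field_product V W \<longleftrightarrow> (\<exists>w\<in>V. \<exists>t\<in>W. u = join w t)"
proof
  assume u: "u \<in> field_product V W"
  have "u = join (\<lambda>x. (fst (u x), fst (snd (u x)))) (\<lambda>x. snd (snd (u x)))"
    by (simp add: join_def)
  then show "\<exists>w\<in>V. \<exists>t\<in>W. u = join w t"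
    using u by (intro bexI) (auto simp: field_product_def)
qed (auto simp: field_product_def join_def)

lemma Z1h_iff: "u \<in> Z1h m S X1h X0h \<longleftrightarrow> (\<exists>w\<in>X1h. \<exists>t\<in>X0h. ae_eq S u (\<eta>1_inv m (join w t)))"
  unfolding Z1h_def ae_image_def mem_Collect_eq Bex_def field_product_iff by blast

lemma Z2h_iff: "u \<in> Z2h m S X1sh X2h \<longleftrightarrow> (\<exists>v\<in>X1sh. \<exists>d\<in>X2h. ae_eq S u (\<eta>2_inv m (join v d)))"
  unfolding Z2h_def ae_image_def mem_Collect_eq Bex_def field_product_iff by blast

lemma Z0h_iff: "u \<in> Z0h m S X0h \<longleftrightarrow> (\<exists>t\<in>X0h. ae_eq S u (\<eta>0_inv m t))"
  by (auto simp: Z0h_def ae_image_def)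

lemma Z3h_iff: "u \<in> Z3h m S X2h \<longleftrightarrow> u \<in> X2h"
proof -
  have "u \<in> Z3h m S X2h \<longleftrightarrow> (\<exists>d\<in>X2h. ae_eq S u d)"
    by (simp add: Z3h_def ae_image_def \<eta>3_inv_def)
  then show ?thesis
    using ae_mem[OF subspaces(4)] ae_eq_sym[of S] ae_eq_refl[of S] by blast
qed

lemma \<eta>1_inv_ae_eq:
  assumes "ae_eq S (\<eta>1_inv m (join w t)) (\<eta>1_inv m (join w' t'))"
  shows "ae_eq S t t'"
  using assms by (rule ae_eq_map) (simp add: join_def \<eta>1_inv_def)

lemma \<eta>2_inv_ae_eq_0:
  assumes "ae_eq S (\<lambda>_. 0) (\<eta>2_inv m (join v d))"
  shows "ae_eq S v (\<lambda>_. 0)"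
  using assms by (rule ae_eq_map) (simp add: join_def \<eta>2_inv_def prod_eq_iff)

lemma \<eta>0_inv_cong: "ae_eq S t t' \<Longrightarrow> ae_eq S (\<eta>0_inv m t) (\<eta>0_inv m t')"
  by (erule ae_eq_map) (simp add: \<eta>0_inv_def)

lemma \<eta>1_inv_cong: "ae_eq S w w' \<Longrightarrow> ae_eq S (\<eta>1_inv m (join w t)) (\<eta>1_inv m (join w' t))"
  by (erule ae_eq_map) (simp add: \<eta>1_inv_def join_def)

text \<open>
  Every element of a discrete cylindrical space is given here by Cartesian unknowns, together with all
  representatives of its image.
\<close>

lemma gradm_Z0h:
  assumes "u \<in> Z0h m S X0h"
  obtains t g where "t \<in> X0h" "g \<in> X1h" "weak_grad S t g" "ae_eq S u (\<eta>0_inv m t)"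
    "\<forall>v. weak_gradm m S u v \<longleftrightarrow> ae_eq S v (\<eta>1_inv m (join g (\<lambda>x. - t x)))"
proof -
  obtain t where t: "t \<in> X0h" "ae_eq S u (\<eta>0_inv m t)"
    using assms Z0h_iff by blast
  obtain g where "g \<in> X1h" "weak_grad S t g"
    using X0h_grad[OF t(1)] .
  then show thesis
    using that t weak_gradm_iff[OF S pos m] by blast
qed

text \<open>The field \<open>q = grad t + w\<close> has the same curl as \<open>w\<close>, hence the image is \<open>- (P q, curl q)\<close>.\<close>

lemma curlm_Z1h:
  assumes "u \<in> Z1h m S X1h X0h"
  obtains w t g q c where "w \<in> X1h" "t \<in> X0h" "weak_grad S t g" "ae_eq S u (\<eta>1_inv m (join w t))"
    "q = (\<lambda>x. g x + w x)" "q \<in> X1h" "c \<in> X2h" "weak_curl S q c"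
    "\<forall>v. weak_curlm m S u v \<longleftrightarrow> ae_eq S v (\<eta>2_inv m (join (\<lambda>x. - Prot (q x)) (\<lambda>x. - c x)))"
proof -
  obtain w t where w: "w \<in> X1h" and t: "t \<in> X0h" and u: "ae_eq S u (\<eta>1_inv m (join w t))"
    using assms Z1h_iff by blast
  obtain g where g: "g \<in> X1h" "weak_grad S t g" using X0h_grad[OF t] .
  obtain c where c: "c \<in> X2h" "weak_curl S w c" using X1h_curl[OF w] .
  have "weak_curl S (\<lambda>x. g x + w x) c"
    using weak_curl_add[OF S_in_lebesgue weak_curl_grad[OF g(2)] c(2)] by simp
  then show thesis
    using that[OF w t g(2) u refl add_mem[OF subspaces(2) g(1) w] c(1)]
      weak_curlm_iff[OF S pos m c(2) g(2) u] by blast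
qed

text \<open>As \<open>v = P w\<close> with \<open>w \<in> X1h\<close>, the divergence of \<open>v\<close> is \<open>curl w\<close>.\<close>

lemma divm_Z2h:
  assumes "u \<in> Z2h m S X1sh X2h"
  obtains w c d where "w \<in> X1h" "c \<in> X2h" "d \<in> X2h" "weak_curl S w c"
    "ae_eq S u (\<eta>2_inv m (join (\<lambda>x. Prot (w x)) d))"
    "\<forall>v. weak_divm m S u v \<longleftrightarrow> ae_eq S v (\<lambda>x. c x - d x)"
proof -
  obtain v d where v: "v \<in> X1sh" and d: "d \<in> X2h" and u: "ae_eq S u (\<eta>2_inv m (join v d))"
    using assms Z2h_iff by blast
  obtain w where w: "w \<in> X1h" "v = (\<lambda>x. Prot (w x))" using X1sh_Prot[OF v] .
  obtain c where c: "c \<in> X2h" "weak_curl S w c" using X1h_curl[OF w(1)] .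
  show thesis
    using that[OF w(1) c(1) d c(2)] u
      weak_divm_iff[OF S pos m weak_div_Prot[OF c(2)] X2h_locally_integrable[OF d]]
    unfolding w(2) by blast
qed

lemma gradm_maps: "op_maps (weak_gradm m S) (Z0h m S X0h) (Z1h m S X1h X0h)"
  unfolding op_maps_def
proof (intro conjI ballI)
  fix u assume u: "u \<in> Z0h m S X0h"
  obtain t g where t: "t \<in> X0h" "g \<in> X1h" "weak_grad S t g" "ae_eq S u (\<eta>0_inv m t)"
    and iff: "\<forall>v. weak_gradm m S u v \<longleftrightarrow> ae_eq S v (\<eta>1_inv m (join g (\<lambda>x. - t x)))"
    using gradm_Z0h[OF u] .
  show "\<exists>v. weak_gradm m S u v"
    unfolding iff[rule_format] using ae_eq_refl by blast
next
  show "op_image (weak_gradm m S) (Z0h m S X0h) \<subseteq> Z1h m S X1h X0h"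
  proof
    fix v assume "v \<in> op_image (weak_gradm m S) (Z0h m S X0h)"
    then obtain u where u: "u \<in> Z0h m S X0h" "weak_gradm m S u v"
      by (auto simp: op_image_def)
    obtain t g where t: "t \<in> X0h" "g \<in> X1h" "weak_grad S t g" "ae_eq S u (\<eta>0_inv m t)"
    and iff: "\<forall>v. weak_gradm m S u v \<longleftrightarrow> ae_eq S v (\<eta>1_inv m (join g (\<lambda>x. - t x)))"
    using gradm_Z0h[OF u(1)] .
    with u(2) show "v \<in> Z1h m S X1h X0h"
      unfolding Z1h_iff iff[rule_format] using minus_mem[OF subspaces(1) t(1)] by blast
  qed
qed

lemma curlm_maps: "op_maps (weak_curlm m S) (Z1h m S X1h X0h) (Z2h m S X1sh X2h)"
  unfolding op_maps_def
proof (intro conjI ballI)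
  fix u assume u: "u \<in> Z1h m S X1h X0h"
  obtain w t g q c where t: "w \<in> X1h" "t \<in> X0h" "weak_grad S t g" "ae_eq S u (\<eta>1_inv m (join w t))"
    and q: "q = (\<lambda>x. g x + w x)" "q \<in> X1h" "c \<in> X2h" "weak_curl S q c"
    and iff: "\<forall>v. weak_curlm m S u v \<longleftrightarrow> ae_eq S v (\<eta>2_inv m (join (\<lambda>x. - Prot (q x)) (\<lambda>x. - c x)))"
    using curlm_Z1h[OF u] .
  show "\<exists>v. weak_curlm m S u v"
    unfolding iff[rule_format] using ae_eq_refl by blast
next
  show "op_image (weak_curlm m S) (Z1h m S X1h X0h) \<subseteq> Z2h m S X1sh X2h"
  proof
    fix v assume "v \<in> op_image (weak_curlm m S) (Z1h m S X1h X0h)"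
    then obtain u where u: "u \<in> Z1h m S X1h X0h" "weak_curlm m S u v"
      by (auto simp: op_image_def)
    obtain w t g q c where t: "w \<in> X1h" "t \<in> X0h" "weak_grad S t g" "ae_eq S u (\<eta>1_inv m (join w t))"
    and q: "q = (\<lambda>x. g x + w x)" "q \<in> X1h" "c \<in> X2h" "weak_curl S q c"
    and iff: "\<forall>v. weak_curlm m S u v \<longleftrightarrow> ae_eq S v (\<eta>2_inv m (join (\<lambda>x. - Prot (q x)) (\<lambda>x. - c x)))"
    using curlm_Z1h[OF u(1)] .
    with u(2) show "v \<in> Z2h m S X1sh X2h"
      unfolding Z2h_iff iff[rule_format]
      using minus_mem[OF subspaces(3) Prot_mem[OF q(2)]] minus_mem[OF subspaces(4) q(3)] by blast
  qed
qed

lemma divm_maps: "op_maps (weak_divm m S) (Z2h m S X1sh X2h) (Z3h m S X2h)"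
  unfolding op_maps_def
proof (intro conjI ballI)
  fix u assume u: "u \<in> Z2h m S X1sh X2h"
  obtain w c d where w: "w \<in> X1h" "c \<in> X2h" "d \<in> X2h" "weak_curl S w c"
    "ae_eq S u (\<eta>2_inv m (join (\<lambda>x. Prot (w x)) d))"
    and iff: "\<forall>v. weak_divm m S u v \<longleftrightarrow> ae_eq S v (\<lambda>x. c x - d x)"
    using divm_Z2h[OF u] .
  show "\<exists>v. weak_divm m S u v"
    unfolding iff[rule_format] using ae_eq_refl by blast
next
  show "op_image (weak_divm m S) (Z2h m S X1sh X2h) \<subseteq> Z3h m S X2h"
  proof
    fix v assume "v \<in> op_image (weak_divm m S) (Z2h m S X1sh X2h)"
    then obtain u where u: "u \<in> Z2h m S X1sh X2h" "weak_divm m S u v"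
      by (auto simp: op_image_def)
    obtain w c d where w: "w \<in> X1h" "c \<in> X2h" "d \<in> X2h" "weak_curl S w c"
    "ae_eq S u (\<eta>2_inv m (join (\<lambda>x. Prot (w x)) d))"
    and iff: "\<forall>v. weak_divm m S u v \<longleftrightarrow> ae_eq S v (\<lambda>x. c x - d x)"
    using divm_Z2h[OF u(1)] .
    have "(\<lambda>x. c x - d x) \<in> X2h"
      using add_mem[OF subspaces(4) w(2) minus_mem[OF subspaces(4) w(3)]] by simp
    then show "v \<in> Z3h m S X2h"
      unfolding Z3h_iff using ae_mem[OF subspaces(4) _ ae_eq_sym[OF u(2)[unfolded iff[rule_format]]]] by blast
  qed
qed

lemma gradm_injective: "op_injective S (weak_gradm m S) (Z0h m S X0h)"
  unfolding op_injective_def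
proof (intro ballI allI impI)
  fix u u' v
  assume u: "u \<in> Z0h m S X0h" and u': "u' \<in> Z0h m S X0h"
    and v: "weak_gradm m S u v \<and> weak_gradm m S u' v"
  obtain t g where t: "t \<in> X0h" "g \<in> X1h" "weak_grad S t g" "ae_eq S u (\<eta>0_inv m t)"
    and iff: "\<forall>v. weak_gradm m S u v \<longleftrightarrow> ae_eq S v (\<eta>1_inv m (join g (\<lambda>x. - t x)))"
    using gradm_Z0h[OF u] .
  obtain t' g' where t': "t' \<in> X0h" "g' \<in> X1h" "weak_grad S t' g'" "ae_eq S u' (\<eta>0_inv m t')"
    and iff': "\<forall>v. weak_gradm m S u' v \<longleftrightarrow> ae_eq S v (\<eta>1_inv m (join g' (\<lambda>x. - t' x)))"
    using gradm_Z0h[OF u'] .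
  from v have "ae_eq S v (\<eta>1_inv m (join g (\<lambda>x. - t x)))" "ae_eq S v (\<eta>1_inv m (join g' (\<lambda>x. - t' x)))"
    by (simp_all add: iff iff')
  from \<eta>1_inv_ae_eq[OF ae_eq_trans[OF ae_eq_sym[OF this(1)] this(2)]]
  have "ae_eq S (\<lambda>x. - t x) (\<lambda>x. - t' x)" .
  then have "ae_eq S t t'"
    by (rule ae_eq_map) simp
  then show "ae_eq S u u'"
    by (rule ae_eq_trans[OF t(4) ae_eq_trans[OF \<eta>0_inv_cong ae_eq_sym[OF t'(4)]]])
qed

lemma exact_Z1h: "op_image (weak_gradm m S) (Z0h m S X0h) = op_kernel (weak_curlm m S) (Z1h m S X1h X0h)"
proof (intro equalityI subsetI)
  fix v assume v: "v \<in> op_image (weak_gradm m S) (Z0h m S X0h)"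
  then obtain u where u: "u \<in> Z0h m S X0h" "weak_gradm m S u v"
    by (auto simp: op_image_def)
  obtain t g where t: "t \<in> X0h" "g \<in> X1h" "weak_grad S t g" "ae_eq S u (\<eta>0_inv m t)"
    and iff: "\<forall>v. weak_gradm m S u v \<longleftrightarrow> ae_eq S v (\<eta>1_inv m (join g (\<lambda>x. - t x)))"
    using gradm_Z0h[OF u(1)] .
  \<comment> \<open>The planar part of \<open>v\<close> is \<open>grad t\<close>, which the gradient of the angular part \<open>- t\<close> cancels.\<close>
  have "weak_curlm m S v (\<lambda>_. 0)"
    unfolding weak_curlm_iff[OF S pos m weak_curl_grad[OF t(3)] weak_grad_minus[OF t(3)] u(2)[unfolded iff[rule_format]]]
    by (simp add: join_def \<eta>2_inv_def Prot_components ae_eq_refl zero_prod_def)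
  then show "v \<in> op_kernel (weak_curlm m S) (Z1h m S X1h X0h)"
    using v gradm_maps by (auto simp: op_kernel_def op_maps_def)
next
  fix v assume "v \<in> op_kernel (weak_curlm m S) (Z1h m S X1h X0h)"
  then have v: "v \<in> Z1h m S X1h X0h" "weak_curlm m S v (\<lambda>_. 0)"
    by (auto simp: op_kernel_def)
  obtain w t g q c where t: "w \<in> X1h" "t \<in> X0h" "weak_grad S t g" "ae_eq S v (\<eta>1_inv m (join w t))"
    and q: "q = (\<lambda>x. g x + w x)" "q \<in> X1h" "c \<in> X2h" "weak_curl S q c"
    and iff: "\<forall>v'. weak_curlm m S v v' \<longleftrightarrow> ae_eq S v' (\<eta>2_inv m (join (\<lambda>x. - Prot (q x)) (\<lambda>x. - c x)))"
    using curlm_Z1h[OF v(1)] .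
  from \<eta>2_inv_ae_eq_0[OF v(2)[unfolded iff[rule_format]]] have "ae_eq S w (\<lambda>x. - g x)"
    by (rule ae_eq_map) (auto simp: q(1) Prot_components prod_eq_iff)
  from ae_eq_trans[OF t(4) \<eta>1_inv_cong[OF this]]
  have "weak_gradm m S (\<eta>0_inv m (\<lambda>x. - t x)) v"
    unfolding weak_gradm_iff[OF S pos m weak_grad_minus[OF t(3)] ae_eq_refl] by simp
  moreover have "\<eta>0_inv m (\<lambda>x. - t x) \<in> Z0h m S X0h"
    unfolding Z0h_iff using minus_mem[OF subspaces(1) t(2)] ae_eq_refl by blast
  ultimately show "v \<in> op_image (weak_gradm m S) (Z0h m S X0h)"
    by (auto simp: op_image_def)
qed

lemma exact_Z2h: "op_image (weak_curlm m S) (Z1h m S X1h X0h) = op_kernel (weak_divm m S) (Z2h m S X1sh X2h)"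
proof (intro equalityI subsetI)
  fix v assume v: "v \<in> op_image (weak_curlm m S) (Z1h m S X1h X0h)"
  then obtain u where u: "u \<in> Z1h m S X1h X0h" "weak_curlm m S u v"
    by (auto simp: op_image_def)
  obtain w t g q c where t: "w \<in> X1h" "t \<in> X0h" "weak_grad S t g" "ae_eq S u (\<eta>1_inv m (join w t))"
    and q: "q = (\<lambda>x. g x + w x)" "q \<in> X1h" "c \<in> X2h" "weak_curl S q c"
    and iff: "\<forall>v. weak_curlm m S u v \<longleftrightarrow> ae_eq S v (\<eta>2_inv m (join (\<lambda>x. - Prot (q x)) (\<lambda>x. - c x)))"
    using curlm_Z1h[OF u(1)] .
  have Prot_minus: "(\<lambda>x. - Prot (q x)) = (\<lambda>x. Prot (- q x))"
    by (simp add: Prot_components)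
  have "weak_divm m S v (\<lambda>_. 0)"
    unfolding weak_divm_iff[OF S pos m weak_div_Prot[OF weak_curl_minus[OF q(4)]]
      X2h_locally_integrable[OF minus_mem[OF subspaces(4) q(3)]] u(2)[unfolded iff[rule_format] Prot_minus]]
    by (simp add: ae_eq_refl)
  then show "v \<in> op_kernel (weak_divm m S) (Z2h m S X1sh X2h)"
    using v curlm_maps by (auto simp: op_kernel_def op_maps_def)
next
  fix v assume "v \<in> op_kernel (weak_divm m S) (Z2h m S X1sh X2h)"
  then have v: "v \<in> Z2h m S X1sh X2h" "weak_divm m S v (\<lambda>_. 0)"
    by (auto simp: op_kernel_def)
  obtain w c d where w: "w \<in> X1h" "c \<in> X2h" "d \<in> X2h" "weak_curl S w c"
    "ae_eq S v (\<eta>2_inv m (join (\<lambda>x. Prot (w x)) d))"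
    and iff: "\<forall>v'. weak_divm m S v v' \<longleftrightarrow> ae_eq S v' (\<lambda>x. c x - d x)"
    using divm_Z2h[OF v(1)] .
  have z: "weak_grad S (\<lambda>_. 0) (\<lambda>_. 0)"
    by (simp add: weak_grad_def represents_def locally_integrable_def reg_def D\<rho>_def Dz_def)
  \<comment> \<open>The image of \<open>(- w, 0)\<close> is \<open>(P w, curl w)\<close>, and \<open>curl w = d\<close> by the kernel condition.\<close>
  let ?u = "\<eta>1_inv m (join (\<lambda>x. - w x) (\<lambda>_. 0))"
  have "ae_eq S (\<eta>2_inv m (join (\<lambda>x. Prot (w x)) d)) (\<eta>2_inv m (join (\<lambda>x. Prot (w x)) c))"
    using v(2)[unfolded iff[rule_format]] by (rule ae_eq_map) (simp add: join_def \<eta>2_inv_def)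
  from ae_eq_trans[OF w(5) this] have "weak_curlm m S ?u v"
    unfolding weak_curlm_iff[OF S pos m weak_curl_minus[OF w(4)] z ae_eq_refl]
    by (simp add: Prot_components)
  moreover have "?u \<in> Z1h m S X1h X0h"
    unfolding Z1h_iff using minus_mem[OF subspaces(2) w(1)] zero_mem[OF subspaces(1)] ae_eq_refl by blast
  ultimately show "v \<in> op_image (weak_curlm m S) (Z1h m S X1h X0h)"
    by (auto simp: op_image_def)
qed

lemma divm_surjective: "op_image (weak_divm m S) (Z2h m S X1sh X2h) = Z3h m S X2h"
proof (intro equalityI subsetI)
  fix v assume "v \<in> op_image (weak_divm m S) (Z2h m S X1sh X2h)"
  then show "v \<in> Z3h m S X2h"
    using divm_maps by (auto simp: op_maps_def)
next
  fix v assume "v \<in> Z3h m S X2h"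
  then have d: "(\<lambda>x. - v x) \<in> X2h"
    unfolding Z3h_iff by (rule minus_mem[OF subspaces(4)])
  have z: "weak_div S (\<lambda>_. 0) (\<lambda>_. 0)"
    by (simp add: weak_div_def represents_def locally_integrable_def reg_def D\<rho>_def Dz_def)
  let ?u = "\<eta>2_inv m (join (\<lambda>_. 0) (\<lambda>x. - v x))"
  have "weak_divm m S ?u v"
    by (rule iffD2[OF weak_divm_iff[OF S pos m z X2h_locally_integrable[OF d] ae_eq_refl]])
      (simp add: ae_eq_refl)
  moreover have "?u \<in> Z2h m S X1sh X2h"
    unfolding Z2h_iff using d zero_mem[OF subspaces(3)] ae_eq_refl by blast
  ultimately show "v \<in> op_image (weak_divm m S) (Z2h m S X1sh X2h)"
    by (auto simp: op_image_def)
qed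

end

theorem mainTheorem1:
  fixes m :: int
    and S :: "point set" and F :: "point \<Rightarrow> point"
    and X0h X2h :: "scalar_field set" and X1h X1sh :: "planar_field set"
    and p0 p2 :: "scalar_field \<Rightarrow> scalar_field"
    and p1 p1s :: "planar_field \<Rightarrow> planar_field"
  assumes "m \<noteq> 0"
    and "meridian_domain S F"
    and "discrete_spaces S X0h X1h X1sh X2h"
    and "commuting_projectors S X0h X1h X1sh X2h p0 p1 p1s p2"
  shows "op_maps (weak_gradm m S) (Z0h m S X0h) (Z1h m S X1h X0h) \<and>
         op_maps (weak_curlm m S) (Z1h m S X1h X0h) (Z2h m S X1sh X2h) \<and>
         op_maps (weak_divm m S) (Z2h m S X1sh X2h) (Z3h m S X2h) \<and>
         op_injective S (weak_gradm m S) (Z0h m S X0h) \<and>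
         op_image (weak_gradm m S) (Z0h m S X0h) = op_kernel (weak_curlm m S) (Z1h m S X1h X0h) \<and>
         op_image (weak_curlm m S) (Z1h m S X1h X0h) = op_kernel (weak_divm m S) (Z2h m S X1sh X2h) \<and>
         op_image (weak_divm m S) (Z2h m S X1sh X2h) = Z3h m S X2h"
proof -
  interpret discrete_sequence m S X0h X2h X1h X1sh
    using assms by unfold_locales (auto simp: meridian_domain_def lipschitz_domain_def)
  show ?thesis
    using gradm_maps curlm_maps divm_maps gradm_injective exact_Z1h exact_Z2h divm_surjective by blast
qed

end
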